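(* Let $M$ be a spatial $T_1$ MT-algebra, let $\mathsf{w}M=\mathbf{RO}(X_{\mathcal C(M)})$ be its Wallman extension, and let $\rho_{\mathcal C(M)}:\mathsf{w}M\to M$ be given by $\rho_{\mathcal C(M)}(A)=\bigvee\{a\in\mathrm{at}(M)\mid\sigma_{\mathcal C(M)}(a)\subseteq A\}$. Then $(\mathsf{w}M,\rho_{\mathcal C(M)})$ is a $T_1$-compactification of $M$.
   Context: The result is presented as choice-free (a theorem of ZF). MT-algebras. An MT-algebra is a pair $(M,\square)$, where $M$ is a complete Boolean algebra and $\square:M\to M$ satisfies $\square 1=1$, $\square(a\wedge b)=\square a\wedge\square b$, $\square a\le a$, $\square a\le\square\square a$. Put $\Diamond a=\neg\square\neg a$. An element $a$ is open if $a=\square a$ and closed if $a=\Diamond a$; $\mathcal O(M)$ and $\mathcal C(M)$ are the sets of open and closed elements. An MT-morphism $h:N\to M$ is a complete Boolean homomorphism with $h(\square a)\le\square h(a)$ for all $a$; it restricts to a frame homomorphism $\mathcal O(h):\mathcal O(N)\to\mathcal O(M)$. $M$ is spatial if it is atomic as a Boolean algebra; $\mathrm{at}(M)$ is its set of atoms. $M$ is $T_1$ if every element is a join of closed elements. $M$ is compact if whenever $\bigvee S=1$ with $S\subseteq\mathcal O(M)$, there is a finite $T\subseteq S$ with $\bigvee T=1$. An MT-morphism $h:N\to M$ is dense if $h(u)=0$ implies $u=0$ for every $u\in\mathcal O(N)$, and is an MT-embedding if both $h$ and $\mathcal O(h)$ are onto. A compactification of $M$ is a pair $(N,h)$ with $N$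 a compact MT-algebra and $h:N\to M$ a dense MT-embedding; it is a $T_1$-compactification if $N$ is $T_1$. The algebra $\mathbf{RO}(X_{\mathcal B})$. For a bounded sublattice $\mathcal B$ of $\mathcal C(M)$ (here $\mathcal B=\mathcal C(M)$), $X_{\mathcal B}$ is the set of proper filters of $\mathcal B$ ordered by inclusion and given the topology of upsets. $\mathbf{RO}(X_{\mathcal B})$ is the complete Boolean algebra of regular open sets of $X_{\mathcal B}$, i.e. upsets $U$ with $U=\{x\mid \mathord{\uparrow}x\subseteq\mathord{\downarrow}U\}$. For $a\in M$, $$\sigma_{\mathcal B}(a)=\{x\in X_{\mathcal B}\mid \text{for all } y\in X_{\mathcal B}\text{ with }x\subseteq y\text{ and all }b\in y,\ a\wedge b\ne0\},$$ which is an element of $\mathbf{RO}(X_{\mathcal B})$. $\mathbf{RO}(X_{\mathcal B})$ is made an MT-algebra by declaring its closed elements to be the arbitrary meets of elements of $\{\sigma_{\mathcal B}(b)\mid b\in\mathcal B\}$ (the open elements are the complements of closed ones, and $\square A$ is the largest open element below $A$). *)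

theory Defs
  imports "HOL-Analysis.Abstract_Topology" "HOL-Algebra.Complete_Lattice"
begin

text \<open>
  The type class \<open>complete_boolean_algebra\<close> is not usable here: it is completely distributive,
  and the algebra of regular open sets below depends on a value (the given MT-algebra), so that it
  cannot be a type. Complete Boolean algebras are therefore complete lattices in the sense of
  HOL-Algebra, with an explicit carrier. The one-element algebra is allowed.
\<close>

definition is_complement :: "('a, 'm) gorder_scheme \<Rightarrow> 'a \<Rightarrow> 'a \<Rightarrow> bool" where
  "is_complement L a b \<longleftrightarrow> b \<in> carrier L \<and> a \<sqinter>\<^bsub>L\<^esub> b = \<bottom>\<^bsub>L\<^esub> \<and> a \<squnion>\<^bsub>L\<^esub> b = \<top>\<^bsub>L\<^esub>"

definition complement :: "('a, 'm) gorder_scheme \<Rightarrow> 'a \<Rightarrow> 'a" where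
  "complement L a = (THE b. is_complement L a b)"

locale complete_boolean_lattice = complete_lattice L for L (structure) +
  assumes meet_join_distrib:
      "\<lbrakk>a \<in> carrier L; b \<in> carrier L; c \<in> carrier L\<rbrakk>
        \<Longrightarrow> a \<sqinter> (b \<squnion> c) = (a \<sqinter> b) \<squnion> (a \<sqinter> c)"
    and complement_exists: "a \<in> carrier L \<Longrightarrow> \<exists>b. is_complement L a b"

definition atoms :: "('a, 'm) gorder_scheme \<Rightarrow> 'a set" where
  "atoms L = {a \<in> carrier L. a \<noteq> \<bottom>\<^bsub>L\<^esub> \<and>
     (\<forall>b \<in> carrier L. b \<sqsubseteq>\<^bsub>L\<^esub> a \<longrightarrow> b = \<bottom>\<^bsub>L\<^esub> \<or> b = a)}"


section \<open>MT-algebras\<close>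

record 'a mt = "'a gorder" +
  box :: "'a \<Rightarrow> 'a"

locale mt_algebra = complete_boolean_lattice M for M (structure) +
  assumes box_in_carrier: "a \<in> carrier M \<Longrightarrow> box M a \<in> carrier M"
    and box_top: "box M \<top> = \<top>"
    and box_meet:
      "\<lbrakk>a \<in> carrier M; b \<in> carrier M\<rbrakk> \<Longrightarrow> box M (a \<sqinter> b) = box M a \<sqinter> box M b"
    and box_le: "a \<in> carrier M \<Longrightarrow> box M a \<sqsubseteq> a"
    and box_le_box_box: "a \<in> carrier M \<Longrightarrow> box M a \<sqsubseteq> box M (box M a)"

definition diamond :: "('a, 'm) mt_scheme \<Rightarrow> 'a \<Rightarrow> 'a" where
  "diamond M a = complement M (box M (complement M a))"

definition opens :: "('a, 'm) mt_scheme \<Rightarrow> 'a set" where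
  "opens M = {a \<in> carrier M. a = box M a}"

definition closeds :: "('a, 'm) mt_scheme \<Rightarrow> 'a set" where
  "closeds M = {a \<in> carrier M. a = diamond M a}"

definition mt_spatial :: "('a, 'm) mt_scheme \<Rightarrow> bool" where
  "mt_spatial M \<longleftrightarrow>
     (\<forall>b \<in> carrier M. b \<noteq> \<bottom>\<^bsub>M\<^esub> \<longrightarrow> (\<exists>a \<in> atoms M. a \<sqsubseteq>\<^bsub>M\<^esub> b))"

definition mt_T1 :: "('a, 'm) mt_scheme \<Rightarrow> bool" where
  "mt_T1 M \<longleftrightarrow> (\<forall>a \<in> carrier M. \<exists>S \<subseteq> closeds M. a = \<Squnion>\<^bsub>M\<^esub> S)"

definition mt_compact :: "('a, 'm) mt_scheme \<Rightarrow> bool" where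
  "mt_compact M \<longleftrightarrow>
     (\<forall>S \<subseteq> opens M. \<Squnion>\<^bsub>M\<^esub> S = \<top>\<^bsub>M\<^esub> \<longrightarrow> (\<exists>T \<subseteq> S. finite T \<and> \<Squnion>\<^bsub>M\<^esub> T = \<top>\<^bsub>M\<^esub>))"

text \<open>Preservation of the bounds is the case \<open>S = {}\<close> of the second and third assumption.\<close>

locale mt_morphism = N: mt_algebra N + M: mt_algebra M
  for N :: "('b, 'n) mt_scheme" and M :: "('a, 'm) mt_scheme" and h :: "'b \<Rightarrow> 'a" +
  assumes hom_carrier: "h \<in> carrier N \<rightarrow> carrier M"
    and hom_Sup: "S \<subseteq> carrier N \<Longrightarrow> h (\<Squnion>\<^bsub>N\<^esub> S) = \<Squnion>\<^bsub>M\<^esub> (h ` S)"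
    and hom_Inf: "S \<subseteq> carrier N \<Longrightarrow> h (\<Sqinter>\<^bsub>N\<^esub> S) = \<Sqinter>\<^bsub>M\<^esub> (h ` S)"
    and hom_complement: "a \<in> carrier N \<Longrightarrow> h (complement N a) = complement M (h a)"
    and hom_box: "a \<in> carrier N \<Longrightarrow> h (box N a) \<sqsubseteq>\<^bsub>M\<^esub> box M (h a)"

definition mt_dense :: "('b, 'n) mt_scheme \<Rightarrow> ('a, 'm) mt_scheme \<Rightarrow> ('b \<Rightarrow> 'a) \<Rightarrow> bool" where
  "mt_dense N M h \<longleftrightarrow> (\<forall>u \<in> opens N. h u = \<bottom>\<^bsub>M\<^esub> \<longrightarrow> u = \<bottom>\<^bsub>N\<^esub>)"

definition mt_embedding :: "('b, 'n) mt_scheme \<Rightarrow> ('a, 'm) mt_scheme \<Rightarrow> ('b \<Rightarrow> 'a) \<Rightarrow> bool" where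
  "mt_embedding N M h \<longleftrightarrow>
     mt_morphism N M h \<and> h ` carrier N = carrier M \<and> h ` opens N = opens M"

definition mt_compactification ::
    "('a, 'm) mt_scheme \<Rightarrow> ('b, 'n) mt_scheme \<Rightarrow> ('b \<Rightarrow> 'a) \<Rightarrow> bool" where
  "mt_compactification M N h \<longleftrightarrow>
     mt_algebra N \<and> mt_compact N \<and> mt_embedding N M h \<and> mt_dense N M h"

definition mt_T1_compactification ::
    "('a, 'm) mt_scheme \<Rightarrow> ('b, 'n) mt_scheme \<Rightarrow> ('b \<Rightarrow> 'a) \<Rightarrow> bool" where
  "mt_T1_compactification M N h \<longleftrightarrow> mt_compactification M N h \<and> mt_T1 N"


section \<open>Regular open sets of proper filters\<close>

text \<open>In what follows \<open>B\<close> is meant to be a bounded sublattice of \<open>M\<close>.\<close>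

definition proper_filters :: "('a, 'm) gorder_scheme \<Rightarrow> 'a set \<Rightarrow> 'a set set" where
  "proper_filters M B = {x. x \<subseteq> B \<and> x \<noteq> {} \<and> x \<noteq> B \<and>
     (\<forall>a \<in> x. \<forall>b \<in> B. a \<sqsubseteq>\<^bsub>M\<^esub> b \<longrightarrow> b \<in> x) \<and>
     (\<forall>a \<in> x. \<forall>b \<in> x. a \<sqinter>\<^bsub>M\<^esub> b \<in> x)}"

definition upset_topology :: "'a set set \<Rightarrow> 'a set topology" where
  "upset_topology X = topology (\<lambda>U. U \<subseteq> X \<and> (\<forall>x \<in> U. \<forall>y \<in> X. x \<subseteq> y \<longrightarrow> y \<in> U))"

definition regular_opens :: "'a topology \<Rightarrow> 'a set set" where
  "regular_opens T = {U. U = T interior_of (Abstract_Topology.closure_of T U)}"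

definition RO_order :: "'a topology \<Rightarrow> 'a set gorder" where
  "RO_order T = \<lparr>carrier = regular_opens T, eq = (=), le = (\<subseteq>)\<rparr>"

definition mt_sigma :: "('a, 'm) gorder_scheme \<Rightarrow> 'a set \<Rightarrow> 'a \<Rightarrow> 'a set set" where
  "mt_sigma M B a = {x \<in> proper_filters M B.
     \<forall>y \<in> proper_filters M B. x \<subseteq> y \<longrightarrow> (\<forall>b \<in> y. a \<sqinter>\<^bsub>M\<^esub> b \<noteq> \<bottom>\<^bsub>M\<^esub>)}"

abbreviation RO_filters :: "('a, 'm) gorder_scheme \<Rightarrow> 'a set \<Rightarrow> 'a set set gorder" where
  "RO_filters M B \<equiv> RO_order (upset_topology (proper_filters M B))"

definition RO_closeds :: "('a, 'm) gorder_scheme \<Rightarrow> 'a set \<Rightarrow> 'a set set set" where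
  "RO_closeds M B = {\<Sqinter>\<^bsub>RO_filters M B\<^esub> S | S. S \<subseteq> mt_sigma M B ` B}"

definition RO_opens :: "('a, 'm) gorder_scheme \<Rightarrow> 'a set \<Rightarrow> 'a set set set" where
  "RO_opens M B = complement (RO_filters M B) ` RO_closeds M B"

definition RO_mt :: "('a, 'm) gorder_scheme \<Rightarrow> 'a set \<Rightarrow> 'a set set mt" where
  "RO_mt M B = gorder.extend (RO_filters M B) (mt.fields
     (\<lambda>A. THE U. greatest (RO_filters M B) U {V \<in> RO_opens M B. V \<subseteq> A}))"

definition wallman :: "('a, 'm) mt_scheme \<Rightarrow> 'a set set mt" where
  "wallman M = RO_mt M (closeds M)"

definition wallman_map :: "('a, 'm) mt_scheme \<Rightarrow> 'a set set \<Rightarrow> 'a" where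
  "wallman_map M A = \<Squnion>\<^bsub>M\<^esub> {a \<in> atoms M. mt_sigma M (closeds M) a \<subseteq> A}"


section \<open>Unfolding the topology\<close>

lemma openin_upset_topology:
  "openin (upset_topology X) U \<longleftrightarrow> U \<subseteq> X \<and> (\<forall>x \<in> U. \<forall>y \<in> X. x \<subseteq> y \<longrightarrow> y \<in> U)"
proof -
  have "istopology (\<lambda>U. U \<subseteq> X \<and> (\<forall>x \<in> U. \<forall>y \<in> X. x \<subseteq> y \<longrightarrow> y \<in> U))"
    unfolding istopology_def by blast
  then show ?thesis
    unfolding upset_topology_def by (simp add: topology_inverse')
qed

lemma topspace_upset_topology [simp]: "topspace (upset_topology X) = X"
proof (rule antisym)
  show "topspace (upset_topology X) \<subseteq> X"
    using openin_topspace[of "upset_topology X"] unfolding openin_upset_topology by blast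
  have "openin (upset_topology X) X"
    unfolding openin_upset_topology by blast
  then show "X \<subseteq> topspace (upset_topology X)"
    by (rule openin_subset)
qed

lemma closure_of_upset_topology:
  "Abstract_Topology.closure_of (upset_topology X) U = {x \<in> X. \<exists>y \<in> U \<inter> X. x \<subseteq> y}"
proof (intro subset_antisym subsetI)
  fix x assume x: "x \<in> Abstract_Topology.closure_of (upset_topology X) U"
  then have "x \<in> X"
    using closure_of_subset_topspace[of "upset_topology X" U] by auto
  have op: "openin (upset_topology X) {y \<in> X. x \<subseteq> y}"
    unfolding openin_upset_topology by blast
  have meets: "\<exists>y. y \<in> U \<and> y \<in> T" if "x \<in> T" "openin (upset_topology X) T" for T
    using x that unfolding in_closure_of by simp
  have "\<exists>y. y \<in> U \<and> y \<in> {y \<in> X. x \<subseteq> y}"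
    by (rule meets[OF _ op]) (simp add: \<open>x \<in> X\<close>)
  then obtain y where "y \<in> U" "y \<in> X" "x \<subseteq> y"
    by auto
  with \<open>x \<in> X\<close> show "x \<in> {x \<in> X. \<exists>y \<in> U \<inter> X. x \<subseteq> y}"
    by auto
next
  fix x assume "x \<in> {x \<in> X. \<exists>y \<in> U \<inter> X. x \<subseteq> y}"
  then obtain y where x: "x \<in> X" and y: "y \<in> U" "y \<in> X" "x \<subseteq> y"
    by auto
  have "\<exists>y. y \<in> U \<and> y \<in> T" if "x \<in> T" "openin (upset_topology X) T" for T
    using that y unfolding openin_upset_topology by metis
  with x show "x \<in> Abstract_Topology.closure_of (upset_topology X) U"
    unfolding in_closure_of by simp
qed

lemma interior_of_upset_topology:
  "upset_topology X interior_of U = {x \<in> X. \<forall>y \<in> X. x \<subseteq> y \<longrightarrow> y \<in> U}"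
proof (intro subset_antisym subsetI)
  fix x assume "x \<in> upset_topology X interior_of U"
  then obtain T where "openin (upset_topology X) T" "x \<in> T" "T \<subseteq> U"
    unfolding interior_of_def by auto
  then have "x \<in> X" "\<forall>y \<in> X. x \<subseteq> y \<longrightarrow> y \<in> T" "T \<subseteq> U"
    unfolding openin_upset_topology by (metis subsetD)+
  then show "x \<in> {x \<in> X. \<forall>y \<in> X. x \<subseteq> y \<longrightarrow> y \<in> U}"
    by auto
next
  fix x assume x: "x \<in> {x \<in> X. \<forall>y \<in> X. x \<subseteq> y \<longrightarrow> y \<in> U}"
  have "openin (upset_topology X) {y \<in> X. x \<subseteq> y}"
    unfolding openin_upset_topology by blast
  moreover have "{y \<in> X. x \<subseteq> y} \<subseteq> U" "x \<in> {y \<in> X. x \<subseteq> y}"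
    using x by auto
  ultimately show "x \<in> upset_topology X interior_of U"
    unfolding interior_of_def by blast
qed

lemma regular_opens_upset_topology:
  "U \<in> regular_opens (upset_topology X) \<longleftrightarrow>
     U = {x \<in> X. \<forall>y \<in> X. x \<subseteq> y \<longrightarrow> (\<exists>z \<in> U. z \<in> X \<and> y \<subseteq> z)}"
proof -
  have "upset_topology X interior_of
      (Abstract_Topology.closure_of (upset_topology X) U) =
      {x \<in> X. \<forall>y \<in> X. x \<subseteq> y \<longrightarrow> (\<exists>z \<in> U. z \<in> X \<and> y \<subseteq> z)}"
    unfolding interior_of_upset_topology closure_of_upset_topology
    by (rule Collect_cong) (simp add: Bex_def conj_assoc)
  then show ?thesis
    unfolding regular_opens_def by simp
qed

lemma wallman_simps:
  "carrier (wallman M) = regular_opens (upset_topology (proper_filters M (closeds M)))"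
  "eq (wallman M) = (=)"
  "le (wallman M) = (\<subseteq>)"
  "box (wallman M) A =
     (THE U. greatest (RO_filters M (closeds M)) U {V \<in> RO_opens M (closeds M). V \<subseteq> A})"
  by (simp_all add: wallman_def RO_mt_def RO_order_def gorder.defs mt.defs)

end

theory Submission
  imports Defs
begin

text \<open>
  Since \<open>M\<close> is \<open>T\<^sub>1\<close> and atomic, every atom \<open>a\<close> is closed, so the closed elements above \<open>a\<close> form
  a maximal proper filter \<open>p\<^sub>a\<close>, and \<open>\<sigma>(a) \<subseteq> A\<close> holds iff \<open>p\<^sub>a \<in> A\<close>. Hence \<open>\<rho>(A)\<close> is the join of the
  atoms \<open>a\<close> with \<open>p\<^sub>a \<in> A\<close>. At a maximal point of \<open>X\<close>, arbitrary joins, meets and complements of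
  regular open sets are computed as unions, intersections and set complements, so \<open>\<rho>\<close> is a complete
  homomorphism; \<open>\<rho>(\<sigma>(m)) = m\<close> makes it onto and matches the closed elements on both sides.
  Compactness amounts to generating a filter from closed elements with the finite meet property,
  and \<open>T\<^sub>1\<close> holds because for \<open>x \<in> A\<close> the meet of all \<open>\<sigma>(b)\<close> with \<open>b \<in> x\<close> contains \<open>x\<close> and
  lies in \<open>A\<close>.
\<close>

section \<open>Complete Boolean lattices and MT-algebras\<close>

context complete_boolean_lattice
begin

text \<open>Distributivity makes complements unique, so the definite description behind
  \<open>complement\<close> can be evaluated by exhibiting any one complement.\<close>

lemma complement_eqI:
  assumes a: "a \<in> carrier L" and b: "is_complement L a b"
  shows "complement L a = b"
proof -
  have le: "c \<sqsubseteq> d" if c: "is_complement L a c" and d: "is_complement L a d" for c d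
  proof -
    have cd: "c \<in> carrier L" "d \<in> carrier L"
      using c d by (auto simp: is_complement_def)
    have "c = c \<sqinter> \<top>"
      using cd top_meet[of c] by (simp add: meet_comm eq_is_equal)
    also have "\<dots> = c \<sqinter> (a \<squnion> d)"
      using d by (simp add: is_complement_def)
    also have "\<dots> = (c \<sqinter> a) \<squnion> (c \<sqinter> d)"
      using a cd by (simp add: meet_join_distrib)
    also have "c \<sqinter> a = \<bottom>"
      using c by (simp add: is_complement_def meet_comm)
    also have "\<bottom> \<squnion> (c \<sqinter> d) = c \<sqinter> d"
      using cd bottom_join[of "c \<sqinter> d"] by (simp add: eq_is_equal)
    finally show ?thesis
      using cd meet_right[of c d] by simp
  qed
  have "c = b" if "is_complement L a c" for c
    using le[OF that b] le[OF b that] that b by (auto simp: is_complement_def)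
  then show ?thesis
    unfolding complement_def using b by blast
qed

lemma is_complement_complement:
  assumes "a \<in> carrier L"
  shows "is_complement L a (complement L a)"
  using complement_exists[OF assms] complement_eqI[OF assms] by metis

lemma complement_closed [simp]: "a \<in> carrier L \<Longrightarrow> complement L a \<in> carrier L"
  and meet_complement: "a \<in> carrier L \<Longrightarrow> a \<sqinter> complement L a = \<bottom>"
  and join_complement: "a \<in> carrier L \<Longrightarrow> a \<squnion> complement L a = \<top>"
  using is_complement_complement[of a] by (auto simp: is_complement_def)

lemma complement_complement [simp]:
  assumes "a \<in> carrier L"
  shows "complement L (complement L a) = a"
  using assms meet_complement[of a] join_complement[of a]
  by (intro complement_eqI)
    (simp_all add: is_complement_def meet_comm[of _ a] join_comm[of _ a])

lemma le_bottom_iff: "a \<in> carrier L \<Longrightarrow> a \<sqsubseteq> \<bottom> \<longleftrightarrow> a = \<bottom>"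
  using bottom_lower le_antisym by auto

lemma meet_mono:
  assumes "a \<sqsubseteq> c" "b \<sqsubseteq> d" "a \<in> carrier L" "b \<in> carrier L" "c \<in> carrier L" "d \<in> carrier L"
  shows "a \<sqinter> b \<sqsubseteq> c \<sqinter> d"
  using assms by (meson le_trans meet_closed meet_left meet_le meet_right)

text \<open>Splitting \<open>b\<close> along \<open>a\<close> and its complement leaves only the
  second piece when the first vanishes. The order-reversing behaviour of \<open>complement\<close>
  is derived from this.\<close>

lemma meet_eq_bottom_iff:
  assumes a: "a \<in> carrier L" and b: "b \<in> carrier L"
  shows "a \<sqinter> b = \<bottom> \<longleftrightarrow> b \<sqsubseteq> complement L a"
proof
  assume eq: "a \<sqinter> b = \<bottom>"
  have "b = b \<sqinter> (a \<squnion> complement L a)"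
    using b join_complement[OF a] top_meet[of b] by (simp add: meet_comm eq_is_equal)
  also have "\<dots> = (b \<sqinter> a) \<squnion> (b \<sqinter> complement L a)"
    using a b by (simp add: meet_join_distrib)
  also have "\<dots> = b \<sqinter> complement L a"
    using a b eq bottom_join[of "b \<sqinter> complement L a"] by (simp add: meet_comm eq_is_equal)
  finally show "b \<sqsubseteq> complement L a"
    using a b meet_right[of b "complement L a"] by simp
next
  assume "b \<sqsubseteq> complement L a"
  then have "a \<sqinter> b \<sqsubseteq> a \<sqinter> complement L a"
    using a b by (intro meet_mono) auto
  then show "a \<sqinter> b = \<bottom>"
    using a b by (simp add: meet_complement le_bottom_iff)
qed

lemma complement_le_swap:
  assumes "a \<in> carrier L" "b \<in> carrier L"
  shows "b \<sqsubseteq> complement L a \<longleftrightarrow> a \<sqsubseteq> complement L b"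
  using assms meet_eq_bottom_iff[of a b] meet_eq_bottom_iff[of b a] by (simp add: meet_comm)

lemma complement_antimono:
  assumes "a \<sqsubseteq> b" "a \<in> carrier L" "b \<in> carrier L"
  shows "complement L b \<sqsubseteq> complement L a"
  using assms complement_le_swap[of a "complement L b"] by simp

lemma complement_join:
  assumes a: "a \<in> carrier L" and b: "b \<in> carrier L"
  shows "complement L (a \<squnion> b) = complement L a \<sqinter> complement L b"
proof (rule le_antisym)
  show "complement L (a \<squnion> b) \<sqsubseteq> complement L a \<sqinter> complement L b"
    using a b by (intro meet_le complement_antimono join_left join_right) auto
  have "a \<squnion> b \<sqsubseteq> complement L (complement L a \<sqinter> complement L b)"
    using a b complement_antimono[OF meet_left[of "complement L a" "complement L b"]]
      complement_antimono[OF meet_right[of "complement L a" "complement L b"]]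
    by (intro join_le) auto
  then show "complement L a \<sqinter> complement L b \<sqsubseteq> complement L (a \<squnion> b)"
    using a b by (simp add: complement_le_swap)
qed (use a b in auto)

lemma complement_bottom: "complement L \<bottom> = \<top>"
  using bottom_meet[of "\<top>"] bottom_join[of "\<top>"]
  by (intro complement_eqI) (simp_all add: is_complement_def eq_is_equal)

lemma Inf_union:
  assumes "A \<subseteq> carrier L" "B \<subseteq> carrier L"
  shows "\<Sqinter>(A \<union> B) = \<Sqinter>A \<sqinter> \<Sqinter>B"
proof (rule le_antisym)
  show "\<Sqinter>(A \<union> B) \<sqsubseteq> \<Sqinter>A \<sqinter> \<Sqinter>B"
    using assms by (intro meet_le inf_greatest inf_lower) auto
  have "\<Sqinter>A \<sqinter> \<Sqinter>B \<sqsubseteq> x" if "x \<in> A \<union> B" for x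
  proof -
    have "\<Sqinter>A \<sqsubseteq> x \<or> \<Sqinter>B \<sqsubseteq> x"
      using that assms inf_lower by blast
    then show ?thesis
      using that assms le_trans[OF meet_left[of "\<Sqinter>A" "\<Sqinter>B"], of x]
        le_trans[OF meet_right[of "\<Sqinter>A" "\<Sqinter>B"], of x] by auto
  qed
  then show "\<Sqinter>A \<sqinter> \<Sqinter>B \<sqsubseteq> \<Sqinter>(A \<union> B)"
    using assms by (intro inf_greatest) auto
qed (use assms in auto)

lemma atom_closed: "a \<in> atoms L \<Longrightarrow> a \<in> carrier L"
  and atom_not_bottom: "a \<in> atoms L \<Longrightarrow> a \<noteq> \<bottom>"
  by (auto simp: atoms_def)

lemma atom_le_atom: "\<lbrakk>a \<in> atoms L; b \<in> atoms L; a \<sqsubseteq> b\<rbrakk> \<Longrightarrow> a = b"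
  by (auto simp: atoms_def)

lemma atom_meet_iff:
  assumes a: "a \<in> atoms L" and b: "b \<in> carrier L"
  shows "a \<sqinter> b \<noteq> \<bottom> \<longleftrightarrow> a \<sqsubseteq> b"
proof
  have ac: "a \<in> carrier L"
    using a by (rule atom_closed)
  assume "a \<sqinter> b \<noteq> \<bottom>"
  then have "a \<sqinter> b = a"
    using a b ac meet_left[of a b] by (auto simp: atoms_def)
  then show "a \<sqsubseteq> b"
    using ac b meet_right[of a b] by simp
next
  have ac: "a \<in> carrier L"
    using a by (rule atom_closed)
  assume "a \<sqsubseteq> b"
  then have "a = a \<sqinter> b"
    using ac b by (simp add: le_iff_join)
  then show "a \<sqinter> b \<noteq> \<bottom>"
    using atom_not_bottom[OF a] by simp
qed

lemma atom_le_complement_iff: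
  assumes "a \<in> atoms L" "b \<in> carrier L"
  shows "a \<sqsubseteq> complement L b \<longleftrightarrow> \<not> a \<sqsubseteq> b"
  using assms atom_meet_iff[of a b] atom_closed[of a] meet_eq_bottom_iff[of b a]
  by (metis meet_comm)

text \<open>An atom is completely join-prime: if it lies below no member of \<open>S\<close>, then
  every member of \<open>S\<close>, and hence the join, lies below the complement of the
  atom.\<close>

lemma atom_le_Sup_iff:
  assumes a: "a \<in> atoms L" and S: "S \<subseteq> carrier L"
  shows "a \<sqsubseteq> \<Squnion>S \<longleftrightarrow> (\<exists>s\<in>S. a \<sqsubseteq> s)"
proof
  have ac: "a \<in> carrier L"
    using a by (rule atom_closed)
  assume le: "a \<sqsubseteq> \<Squnion>S"
  show "\<exists>s\<in>S. a \<sqsubseteq> s"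
  proof (rule ccontr)
    assume "\<not> (\<exists>s\<in>S. a \<sqsubseteq> s)"
    then have "s \<sqsubseteq> complement L a" if "s \<in> S" for s
      using that a S ac atom_le_complement_iff[of a s] complement_le_swap[of a s] by auto
    then have "\<Squnion>S \<sqsubseteq> complement L a"
      using S ac by (intro sup_least) auto
    then have "a \<sqsubseteq> complement L (\<Squnion>S)"
      using S ac by (simp add: complement_le_swap)
    then show False
      using le a S by (simp add: atom_le_complement_iff)
  qed
next
  have ac: "a \<in> carrier L"
    using a by (rule atom_closed)
  assume "\<exists>s\<in>S. a \<sqsubseteq> s"
  then show "a \<sqsubseteq> \<Squnion>S"
    using S ac by (meson le_trans subsetD sup_closed sup_upper)
qed

lemma le_Inf_iff:
  assumes a: "a \<in> carrier L" and S: "S \<subseteq> carrier L"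
  shows "a \<sqsubseteq> \<Sqinter>S \<longleftrightarrow> (\<forall>s\<in>S. a \<sqsubseteq> s)"
  using assms by (meson inf_closed inf_greatest inf_lower le_trans subsetD)

end

section \<open>Open and closed elements of an MT-algebra\<close>

context mt_algebra
begin

lemma box_mono:
  assumes "a \<sqsubseteq> b" "a \<in> carrier M" "b \<in> carrier M"
  shows "box M a \<sqsubseteq> box M b"
proof -
  have "a = a \<sqinter> b"
    using assms by (simp add: le_iff_join)
  then have "box M a = box M a \<sqinter> box M b"
    using assms box_meet by metis
  then show ?thesis
    using assms box_in_carrier meet_right by metis
qed

lemma opensI: "\<lbrakk>a \<in> carrier M; a \<sqsubseteq> box M a\<rbrakk> \<Longrightarrow> a \<in> opens M"
  using box_le[of a] box_in_carrier[of a] by (auto simp: opens_def)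

lemma box_open: "a \<in> carrier M \<Longrightarrow> box M a \<in> opens M"
  by (rule opensI) (simp_all add: box_in_carrier box_le_box_box)

lemma box_greatest:
  assumes "u \<in> opens M" "a \<in> carrier M" "u \<sqsubseteq> a"
  shows "u \<sqsubseteq> box M a"
  using assms box_mono[of u a] by (auto simp: opens_def)

lemma closeds_iff: "a \<in> closeds M \<longleftrightarrow> a \<in> carrier M \<and> complement M a \<in> opens M"
proof (cases "a \<in> carrier M")
  case True
  have "a = complement M (box M (complement M a)) \<longleftrightarrow> complement M a = box M (complement M a)"
    using True box_in_carrier by (metis complement_closed complement_complement)
  then show ?thesis
    using True by (simp add: closeds_def opens_def diamond_def)
qed (simp add: closeds_def)

lemma opens_carrier: "a \<in> opens M \<Longrightarrow> a \<in> carrier M"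
  by (simp add: opens_def)

lemma closeds_carrier: "a \<in> closeds M \<Longrightarrow> a \<in> carrier M"
  by (simp add: closeds_def)

lemma open_iff_complement_closed:
  "a \<in> carrier M \<Longrightarrow> a \<in> opens M \<longleftrightarrow> complement M a \<in> closeds M"
  by (simp add: closeds_iff)

text \<open>The complement of a member \<open>s\<close> is an open element below the complement of
  the meet, hence below the box of that complement. Taking complements again puts the closure of the
  meet below every \<open>s\<close>.\<close>

lemma Inf_closeds:
  assumes S: "S \<subseteq> closeds M"
  shows "\<Sqinter>S \<in> closeds M"
proof -
  have Sc: "S \<subseteq> carrier M"
    using S closeds_carrier by auto
  let ?c = "complement M (\<Sqinter>S)"
  have "complement M (box M ?c) \<sqsubseteq> \<Sqinter>S"
  proof (rule inf_greatest)
    fix s assume s: "s \<in> S"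
    then have sc: "s \<in> carrier M" "complement M s \<in> opens M"
      using S closeds_iff by auto
    have "complement M s \<sqsubseteq> box M ?c"
      using s sc Sc by (intro box_greatest complement_antimono inf_lower) auto
    then show "complement M (box M ?c) \<sqsubseteq> s"
      using sc Sc complement_antimono[of "complement M s" "box M ?c"]
      by (simp add: box_in_carrier)
  qed (use Sc in \<open>auto simp: box_in_carrier\<close>)
  then have "?c \<sqsubseteq> box M ?c"
    using Sc complement_antimono[of "complement M (box M ?c)" "\<Sqinter>S"] by (simp add: box_in_carrier)
  then show ?thesis
    using Sc by (simp add: closeds_iff opensI)
qed

lemma meet_closeds: "\<lbrakk>a \<in> closeds M; b \<in> closeds M\<rbrakk> \<Longrightarrow> a \<sqinter> b \<in> closeds M"
  unfolding meet_def by (rule Inf_closeds) simp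

lemma top_closeds: "\<top> \<in> closeds M"
  using Inf_closeds[of "{}"] weak_inf_empty by (simp add: eq_is_equal)

lemma bottom_closeds: "\<bottom> \<in> closeds M"
  by (simp add: closeds_iff complement_bottom opens_def box_top)

lemma join_closeds: "\<lbrakk>a \<in> closeds M; b \<in> closeds M\<rbrakk> \<Longrightarrow> a \<squnion> b \<in> closeds M"
  by (auto simp: closeds_iff complement_join opens_def box_meet)

end

section \<open>Regular open sets of upsets\<close>

text \<open>\<open>L\<close> is a parameter because two structures share this carrier and order:
  \<open>wallman M\<close>, and the bare lattice \<open>RO_filters M (closeds M)\<close> through
  which the closed elements and the box of \<open>wallman M\<close> are defined.\<close>

locale regular_open_lattice =
  fixes X :: "'a set set" and L :: "('a set set, 'm) gorder_scheme" (structure)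
  assumes carrier_eq: "carrier L = regular_opens (upset_topology X)"
    and eq_eq: "eq L = (=)"
    and le_eq: "le L = (\<subseteq>)"
begin

text \<open>The interior of the closure of \<open>U\<close>; it coincides with
  \<open>neg (neg U)\<close>.\<close>

definition regularize :: "'a set set \<Rightarrow> 'a set set" where
  "regularize U = {x \<in> X. \<forall>y \<in> X. x \<subseteq> y \<longrightarrow> (\<exists>z \<in> U. z \<in> X \<and> y \<subseteq> z)}"

text \<open>The interior of the set complement. For an upset \<open>U\<close> it is the
  pseudocomplement in the Heyting algebra of upsets.\<close>

definition neg :: "'a set set \<Rightarrow> 'a set set" where
  "neg U = {x \<in> X. \<forall>y \<in> X. x \<subseteq> y \<longrightarrow> y \<notin> U}"

lemma mem_carrier: "U \<in> carrier L \<longleftrightarrow> U = regularize U"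
  unfolding carrier_eq regularize_def by (rule regular_opens_upset_topology)

lemma carrier_subset: "U \<in> carrier L \<Longrightarrow> U \<subseteq> X"
  unfolding mem_carrier regularize_def by blast

lemma carrier_upset: "\<lbrakk>U \<in> carrier L; x \<in> U; y \<in> X; x \<subseteq> y\<rbrakk> \<Longrightarrow> y \<in> U"
  unfolding mem_carrier regularize_def by (smt (verit) mem_Collect_eq subset_trans)

text \<open>A regular open set equals the interior of its closure, so membership of \<open>x\<close>
  may be tested by density above \<open>x\<close>.\<close>

lemma carrier_memI:
  assumes "U \<in> carrier L" "x \<in> X" "\<And>y. \<lbrakk>y \<in> X; x \<subseteq> y\<rbrakk> \<Longrightarrow> \<exists>z\<in>U. y \<subseteq> z"
  shows "x \<in> U"
proof -
  have "x \<in> regularize U"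
    using assms(2,3) carrier_subset[OF assms(1)] unfolding regularize_def by blast
  then show ?thesis
    using assms(1) mem_carrier[of U] by simp
qed

lemma carrierI:
  assumes "U \<subseteq> X" "\<And>x y. \<lbrakk>x \<in> U; y \<in> X; x \<subseteq> y\<rbrakk> \<Longrightarrow> y \<in> U"
    and "\<And>x. \<lbrakk>x \<in> X; \<forall>y\<in>X. x \<subseteq> y \<longrightarrow> (\<exists>z\<in>U. y \<subseteq> z)\<rbrakk> \<Longrightarrow> x \<in> U"
  shows "U \<in> carrier L"
proof -
  have "x \<in> regularize U" if "x \<in> U" for x
    using assms(1) assms(2)[OF that] that unfolding regularize_def by blast
  moreover have "x \<in> U" if "x \<in> regularize U" for x
    using assms(3)[of x] that unfolding regularize_def by blast
  ultimately show ?thesis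
    unfolding mem_carrier by blast
qed

text \<open>A point of the upset \<open>U\<close> has no member of \<open>neg U\<close> above it. So
  if \<open>neg U\<close> is dense above \<open>x\<close>, no point above \<open>x\<close> can lie
  in \<open>U\<close>.\<close>

lemma neg_closed:
  assumes "\<And>x y. \<lbrakk>x \<in> U; x \<in> X; y \<in> X; x \<subseteq> y\<rbrakk> \<Longrightarrow> y \<in> U"
  shows "neg U \<in> carrier L"
proof (rule carrierI)
  fix x assume x: "x \<in> X" and *: "\<forall>y\<in>X. x \<subseteq> y \<longrightarrow> (\<exists>z\<in>neg U. y \<subseteq> z)"
  show "x \<in> neg U"
    unfolding neg_def using x * assms unfolding neg_def by blast
qed (auto simp: neg_def)

lemma neg_carrier: "U \<in> carrier L \<Longrightarrow> neg U \<in> carrier L"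
  by (rule neg_closed) (rule carrier_upset)

lemma neg_neg:
  assumes U: "U \<in> carrier L"
  shows "neg (neg U) = U"
proof
  show "U \<subseteq> neg (neg U)"
    using carrier_subset[OF U] carrier_upset[OF U] unfolding neg_def by blast
  show "neg (neg U) \<subseteq> U"
  proof
    fix x assume x: "x \<in> neg (neg U)"
    show "x \<in> U"
    proof (rule carrier_memI[OF U])
      show "x \<in> X"
        using x by (simp add: neg_def)
      fix y assume "y \<in> X" "x \<subseteq> y"
      then show "\<exists>z\<in>U. y \<subseteq> z"
        using x unfolding neg_def by blast
    qed
  qed
qed

lemma neg_antimono: "U \<subseteq> V \<Longrightarrow> neg V \<subseteq> neg U"
  unfolding neg_def by blast

text \<open>Density of the intersection above a point gives density of each member, so meets need no
  regularization. The factor \<open>X\<close> is the value of the empty meet.\<close>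

lemma Int_closed: "S \<subseteq> carrier L \<Longrightarrow> X \<inter> \<Inter>S \<in> carrier L"
proof (rule carrierI)
  fix x assume S: "S \<subseteq> carrier L" and x: "x \<in> X"
    and *: "\<forall>y\<in>X. x \<subseteq> y \<longrightarrow> (\<exists>z\<in>X \<inter> \<Inter>S. y \<subseteq> z)"
  have "x \<in> U" if "U \<in> S" for U
  proof (rule carrier_memI[OF _ x])
    show "U \<in> carrier L"
      using S that by blast
    show "\<exists>z\<in>U. y \<subseteq> z" if "y \<in> X" "x \<subseteq> y" for y
      using * \<open>U \<in> S\<close> that by (meson IntD2 InterD)
  qed
  then show "x \<in> X \<inter> \<Inter>S"
    using x by blast
qed (use carrier_upset in blast)+

lemma regularize_closed:
  assumes "\<And>x y. \<lbrakk>x \<in> U; x \<in> X; y \<in> X; x \<subseteq> y\<rbrakk> \<Longrightarrow> y \<in> U"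
  shows "regularize U \<in> carrier L"
proof -
  have "regularize U = neg (neg U)"
    unfolding regularize_def neg_def by blast
  also have "\<dots> \<in> carrier L"
    by (rule neg_closed) (auto simp: neg_def)
  finally show ?thesis .
qed

lemma regularize_Union_closed: "S \<subseteq> carrier L \<Longrightarrow> regularize (\<Union>S) \<in> carrier L"
  by (rule regularize_closed) (use carrier_upset in blast)

lemma regularize_minimal:
  assumes "U \<subseteq> V" "V \<in> carrier L"
  shows "regularize U \<subseteq> V"
proof -
  have "regularize U \<subseteq> regularize V"
    using assms(1) unfolding regularize_def by blast
  then show ?thesis
    using assms(2) mem_carrier by simp
qed

lemma regularize_extensive:
  assumes "U \<subseteq> X" "\<And>x y. \<lbrakk>x \<in> U; x \<in> X; y \<in> X; x \<subseteq> y\<rbrakk> \<Longrightarrow> y \<in> U"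
  shows "U \<subseteq> regularize U"
  using assms unfolding regularize_def by blast

lemma partial_order: "partial_order L"
  by unfold_locales (auto simp: eq_eq le_eq)

text \<open>A union of regular open sets is an upset but may fail to be regular;
  \<open>regularize\<close> adds only points that every regular upper bound must contain.\<close>

lemma least_Sup:
  assumes S: "S \<subseteq> carrier L"
  shows "least L (regularize (\<Union>S)) (Upper L S)"
proof (rule least_UpperI)
  fix U assume "U \<in> S"
  moreover have "\<Union>S \<subseteq> regularize (\<Union>S)"
    by (rule regularize_extensive) (use S carrier_subset carrier_upset in blast)+
  ultimately show "U \<sqsubseteq> regularize (\<Union>S)"
    unfolding le_eq by blast
next
  fix V assume "V \<in> Upper L S"
  then have "\<Union>S \<subseteq> V" "V \<in> carrier L"
    using S unfolding Upper_def le_eq by blast+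
  then show "regularize (\<Union>S) \<sqsubseteq> V"
    unfolding le_eq by (rule regularize_minimal)
qed (use S regularize_Union_closed in auto)

lemma greatest_Inf:
  assumes S: "S \<subseteq> carrier L"
  shows "greatest L (X \<inter> \<Inter>S) (Lower L S)"
proof (rule greatest_LowerI)
  fix V assume "V \<in> Lower L S"
  then have "\<forall>U\<in>S. V \<subseteq> U" "V \<in> carrier L"
    using S unfolding Lower_def le_eq by blast+
  then show "V \<sqsubseteq> X \<inter> \<Inter>S"
    unfolding le_eq using carrier_subset by blast
qed (use S Int_closed in \<open>auto simp: le_eq\<close>)

lemma complete_lattice: "complete_lattice L"
proof -
  interpret partial_order L
    by (rule partial_order)
  show ?thesis
    by unfold_locales (use least_Sup greatest_Inf in blast)+
qed

sublocale complete_lattice L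
  by (rule complete_lattice)

lemma Sup_eq: "S \<subseteq> carrier L \<Longrightarrow> \<Squnion>S = regularize (\<Union>S)"
  using least_unique[OF sup_lub least_Sup] by blast

lemma Inf_eq: "S \<subseteq> carrier L \<Longrightarrow> \<Sqinter>S = X \<inter> \<Inter>S"
  using greatest_unique[OF inf_glb greatest_Inf] by blast

lemma meet_eq: "\<lbrakk>U \<in> carrier L; V \<in> carrier L\<rbrakk> \<Longrightarrow> U \<sqinter> V = U \<inter> V"
  using Inf_eq[of "{U, V}"] carrier_subset[of U] unfolding meet_def by auto

lemma join_eq: "\<lbrakk>U \<in> carrier L; V \<in> carrier L\<rbrakk> \<Longrightarrow> U \<squnion> V = regularize (U \<union> V)"
  using Sup_eq[of "{U, V}"] unfolding join_def by auto

lemma bottom_eq_empty: "\<bottom> = {}"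
  using Sup_eq[of "{}"] weak_sup_empty unfolding eq_is_equal by (simp add: regularize_def) blast

lemma top_eq_space: "\<top> = X"
  using Inf_eq[of "{}"] weak_inf_empty unfolding eq_is_equal by simp

lemma is_complement_neg:
  assumes U: "U \<in> carrier L"
  shows "is_complement L U (neg U)"
proof -
  have "U \<inter> neg U = {}"
    using carrier_subset[OF U] unfolding neg_def by blast
  \<comment> \<open>The union is dense: a point outside \<open>neg U\<close> has a member of
    \<open>U\<close> above it.\<close>
  moreover have "regularize (U \<union> neg U) = X"
    unfolding regularize_def neg_def by blast
  ultimately show ?thesis
    unfolding is_complement_def using U neg_carrier[OF U]
    by (simp add: meet_eq join_eq bottom_eq_empty top_eq_space)
qed

sublocale complete_boolean_lattice L
proof
  fix U V W assume UVW: "U \<in> carrier L" "V \<in> carrier L" "W \<in> carrier L"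
  have "U \<inter> regularize (V \<union> W) = regularize ((U \<inter> V) \<union> (U \<inter> W))"
  proof
    \<comment> \<open>A witness in \<open>V\<close> or \<open>W\<close> above a point of
      \<open>U\<close> is itself in \<open>U\<close>, because \<open>U\<close> is an upset.\<close>
    show "U \<inter> regularize (V \<union> W) \<subseteq> regularize ((U \<inter> V) \<union> (U \<inter> W))"
      using carrier_upset[OF UVW(1)] unfolding regularize_def by (auto 0 4)
    have "regularize ((U \<inter> V) \<union> (U \<inter> W)) \<subseteq> U"
      by (rule regularize_minimal) (use UVW in auto)
    then show "regularize ((U \<inter> V) \<union> (U \<inter> W)) \<subseteq> U \<inter> regularize (V \<union> W)"
      unfolding regularize_def by blast
  qed
  then show "U \<sqinter> (V \<squnion> W) = (U \<sqinter> V) \<squnion> (U \<sqinter> W)"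
    using UVW meet_closed[of U V] meet_closed[of U W] join_closed[of V W]
    by (simp add: meet_eq join_eq)
next
  show "\<exists>V. is_complement L U V" if "U \<in> carrier L" for U
    using is_complement_neg[OF that] ..
qed

lemma complement_eq: "U \<in> carrier L \<Longrightarrow> complement L U = neg U"
  by (rule complement_eqI) (auto intro: is_complement_neg)

end

section \<open>The Wallman extension\<close>

locale spatial_T1_mt_algebra = mt_algebra M for M :: "('a, 'm) mt_scheme" (structure) +
  assumes spatial: "mt_spatial M" and T1: "mt_T1 M"
begin

abbreviation filters :: "'a set set" where
  "filters \<equiv> proper_filters M (closeds M)"

abbreviation sigma :: "'a \<Rightarrow> 'a set set" where
  "sigma \<equiv> mt_sigma M (closeds M)"

sublocale W: regular_open_lattice filters "wallman M"
  by unfold_locales (simp_all add: wallman_simps)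

sublocale R: regular_open_lattice filters "RO_filters M (closeds M)"
  by unfold_locales (simp_all add: RO_order_def)

lemma carrier_RO_filters: "carrier (RO_filters M (closeds M)) = carrier (wallman M)"
  by (simp add: R.carrier_eq W.carrier_eq)

section \<open>Proper filters of closed elements\<close>

lemma filters_iff:
  "x \<in> filters \<longleftrightarrow> x \<subseteq> closeds M \<and> \<top> \<in> x \<and> \<bottom> \<notin> x \<and>
     (\<forall>a\<in>x. \<forall>b\<in>closeds M. a \<sqsubseteq> b \<longrightarrow> b \<in> x) \<and> (\<forall>a\<in>x. \<forall>b\<in>x. a \<sqinter> b \<in> x)"
proof -
  have "(x \<noteq> {} \<and> x \<noteq> closeds M) \<longleftrightarrow> (\<top> \<in> x \<and> \<bottom> \<notin> x)"
    if sub: "x \<subseteq> closeds M" and up: "\<forall>a\<in>x. \<forall>b\<in>closeds M. a \<sqsubseteq> b \<longrightarrow> b \<in> x"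
  proof -
    have "x \<noteq> {} \<longleftrightarrow> \<top> \<in> x"
      using sub up top_closeds top_higher closeds_carrier by (meson all_not_in_conv subsetD)
    moreover have "x \<noteq> closeds M \<longleftrightarrow> \<bottom> \<notin> x"
      using sub up bottom_closeds bottom_lower closeds_carrier by (metis subsetD subsetI subset_antisym)
    ultimately show ?thesis
      by simp
  qed
  then show ?thesis
    unfolding proper_filters_def mem_Collect_eq by meson
qed

lemma filter_closeds: "\<lbrakk>x \<in> filters; a \<in> x\<rbrakk> \<Longrightarrow> a \<in> closeds M"
  and filter_top: "x \<in> filters \<Longrightarrow> \<top> \<in> x"
  and filter_bottom: "x \<in> filters \<Longrightarrow> \<bottom> \<notin> x"
  and filter_meet: "\<lbrakk>x \<in> filters; a \<in> x; b \<in> x\<rbrakk> \<Longrightarrow> a \<sqinter> b \<in> x"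
  unfolding filters_iff by blast+

lemma filter_carrier: "\<lbrakk>x \<in> filters; a \<in> x\<rbrakk> \<Longrightarrow> a \<in> carrier M"
  by (rule closeds_carrier) (rule filter_closeds)

text \<open>The upward closure of a filter base. Principal filters, common extensions and the filter
  behind compactness are all instances.\<close>

lemma generated_filter:
  assumes S: "S \<subseteq> closeds M" "S \<noteq> {}" "\<bottom> \<notin> S" "\<And>a b. \<lbrakk>a \<in> S; b \<in> S\<rbrakk> \<Longrightarrow> a \<sqinter> b \<in> S"
  shows "{d \<in> closeds M. \<exists>s\<in>S. s \<sqsubseteq> d} \<in> filters"
proof -
  have Sc: "a \<in> carrier M" if "a \<in> S" for a
    using S that closeds_carrier by blast
  have "a \<sqinter> b \<in> closeds M \<and> (\<exists>s\<in>S. s \<sqsubseteq> a \<sqinter> b)"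
    if "a \<in> closeds M" "b \<in> closeds M" "s \<in> S" "t \<in> S" "s \<sqsubseteq> a" "t \<sqsubseteq> b" for a b s t
  proof
    show "\<exists>s\<in>S. s \<sqsubseteq> a \<sqinter> b"
      using S(4)[OF that(3,4)] meet_mono[OF that(5,6)] that Sc closeds_carrier by blast
  qed (use that meet_closeds in simp)
  moreover have "\<exists>s\<in>S. s \<sqsubseteq> \<top>"
    using S Sc by auto
  moreover have "\<not> s \<sqsubseteq> \<bottom>" if "s \<in> S" for s
    using S(3) Sc that le_bottom_iff by auto
  moreover have "s \<sqsubseteq> b" if "s \<in> S" "a \<in> closeds M" "b \<in> closeds M" "s \<sqsubseteq> a" "a \<sqsubseteq> b" for s a b
    using le_trans[OF that(4,5)] that Sc closeds_carrier by blast
  ultimately show ?thesis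
    unfolding filters_iff using top_closeds by blast
qed

text \<open>By compatibility the meets of a member of \<open>x\<close> with a member of
  \<open>y\<close> form a filter base. The filter it generates contains both \<open>x\<close> and
  \<open>y\<close> because each of them contains \<open>\<top>\<close>.\<close>

lemma common_extension:
  assumes x: "x \<in> filters" and y: "y \<in> filters"
    and compatible: "\<And>a b. \<lbrakk>a \<in> x; b \<in> y\<rbrakk> \<Longrightarrow> a \<sqinter> b \<noteq> \<bottom>"
  obtains z where "z \<in> filters" "x \<subseteq> z" "y \<subseteq> z"
proof
  let ?S = "{a \<sqinter> b | a b. a \<in> x \<and> b \<in> y}"
  show "{d \<in> closeds M. \<exists>s\<in>?S. s \<sqsubseteq> d} \<in> filters"
  proof (rule generated_filter)
    show "?S \<subseteq> closeds M"
      using x y filter_closeds meet_closeds by blast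
    show "?S \<noteq> {}"
      using filter_top x y by blast
    show "\<bottom> \<notin> ?S"
      using compatible by fastforce
    fix s t assume "s \<in> ?S" "t \<in> ?S"
    then obtain a b c d where st: "s = a \<sqinter> b" "t = c \<sqinter> d"
      and mem: "a \<in> x" "b \<in> y" "c \<in> x" "d \<in> y"
      by blast
    then have "a \<in> carrier M" "b \<in> carrier M" "c \<in> carrier M" "d \<in> carrier M"
      using x y filter_carrier by blast+
    then have "s \<sqinter> t = (a \<sqinter> c) \<sqinter> (b \<sqinter> d)"
      unfolding st by (metis meet_assoc meet_closed meet_comm)
    then show "s \<sqinter> t \<in> ?S"
      using mem x y filter_meet by blast
  qed
  show "x \<subseteq> {d \<in> closeds M. \<exists>s\<in>?S. s \<sqsubseteq> d}"
  proof
    fix a assume a: "a \<in> x"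
    have "a \<sqinter> \<top> \<sqsubseteq> a"
      using meet_left x a filter_carrier by simp
    then show "a \<in> {d \<in> closeds M. \<exists>s\<in>?S. s \<sqsubseteq> d}"
      using a x y filter_closeds filter_top by blast
  qed
  show "y \<subseteq> {d \<in> closeds M. \<exists>s\<in>?S. s \<sqsubseteq> d}"
  proof
    fix a assume a: "a \<in> y"
    have "\<top> \<sqinter> a \<sqsubseteq> a"
      using meet_right y a filter_carrier by simp
    then show "a \<in> {d \<in> closeds M. \<exists>s\<in>?S. s \<sqsubseteq> d}"
      using a x y filter_closeds filter_top by blast
  qed
qed

text \<open>For an atom \<open>a\<close> this is the maximal point of the space that represents
  \<open>a\<close>.\<close>

definition principal :: "'a \<Rightarrow> 'a set" where
  "principal a = {b \<in> closeds M. a \<sqsubseteq> b}"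

lemma principal_filter:
  assumes "a \<in> closeds M" "a \<noteq> \<bottom>"
  shows "principal a \<in> filters"
proof -
  have "a \<sqinter> a = a"
    using assms closeds_carrier le_iff_join[of a a] by simp
  then show ?thesis
    using generated_filter[of "{a}"] assms by (simp add: principal_def)
qed

text \<open>If \<open>a\<close> meets every member of \<open>x\<close>, so does every element above
  \<open>a\<close>; hence \<open>x\<close> is compatible with the principal filter of
  \<open>a\<close>.\<close>

lemma extension_by:
  assumes x: "x \<in> filters" and a: "a \<in> closeds M"
    and compatible: "\<And>b. b \<in> x \<Longrightarrow> a \<sqinter> b \<noteq> \<bottom>"
  obtains z where "z \<in> filters" "x \<subseteq> z" "a \<in> z"
proof -
  have ac: "a \<in> carrier M"
    using a by (rule closeds_carrier)
  have "a \<noteq> \<bottom>"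
    using compatible[OF filter_top[OF x]] bottom_meet[of "\<top>"] by (auto simp: eq_is_equal)
  moreover have "b \<sqinter> c \<noteq> \<bottom>" if "b \<in> x" "c \<in> principal a" for b c
  proof
    assume eq: "b \<sqinter> c = \<bottom>"
    have bc: "b \<in> carrier M" "c \<in> carrier M" "a \<sqsubseteq> c"
      using that x filter_carrier closeds_carrier by (auto simp: principal_def)
    then have "a \<sqinter> b \<sqsubseteq> c \<sqinter> b"
      using ac by (intro meet_mono) auto
    then show False
      using eq compatible[OF that(1)] ac bc by (simp add: meet_comm[of _ c] le_bottom_iff)
  qed
  ultimately obtain z where "z \<in> filters" "x \<subseteq> z" "principal a \<subseteq> z"
    using common_extension[OF x principal_filter[OF a]] by metis
  then show ?thesis
    using that a ac by (auto simp: principal_def)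
qed

section \<open>The regular open sets \<open>sigma a\<close>\<close>

lemma sigma_iff:
  "x \<in> sigma a \<longleftrightarrow> x \<in> filters \<and> (\<forall>y\<in>filters. x \<subseteq> y \<longrightarrow> (\<forall>b\<in>y. a \<sqinter> b \<noteq> \<bottom>))"
  by (simp add: mt_sigma_def)

text \<open>An element of a filter that is disjoint from \<open>a\<close> survives in all larger
  filters, so the filters containing such an element form an upset, and \<open>sigma a\<close> is
  its \<open>neg\<close>.\<close>

lemma sigma_carrier: "sigma a \<in> carrier (wallman M)"
proof -
  have "sigma a = W.neg {y. \<exists>b\<in>y. a \<sqinter> b = \<bottom>}"
    unfolding set_eq_iff sigma_iff W.neg_def by blast
  also have "\<dots> \<in> carrier (wallman M)"
    by (rule W.neg_closed) blast
  finally show ?thesis .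
qed

lemma mem_imp_sigma:
  assumes "x \<in> filters" "a \<in> x"
  shows "x \<in> sigma a"
  unfolding sigma_iff using assms filter_meet filter_bottom by (metis subsetD)

text \<open>A filter in \<open>sigma a\<close> is compatible with \<open>a\<close>. Together with
  \<open>mem_imp_sigma\<close> this exhibits \<open>sigma a\<close>, for closed \<open>a\<close>, as
  the regularization of the set of filters containing \<open>a\<close>.\<close>

lemma sigma_extension:
  assumes "x \<in> sigma a" "a \<in> closeds M"
  obtains z where "z \<in> filters" "x \<subseteq> z" "a \<in> z"
  using assms extension_by[of x a] unfolding sigma_iff by blast

lemma sigma_mono:
  assumes "a \<sqsubseteq> b" "a \<in> carrier M" "b \<in> carrier M"
  shows "sigma a \<subseteq> sigma b"
proof
  fix x assume x: "x \<in> sigma a"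
  have "b \<sqinter> c \<noteq> \<bottom>" if y: "y \<in> filters" "x \<subseteq> y" "c \<in> y" for y c
  proof
    assume eq: "b \<sqinter> c = \<bottom>"
    have c: "c \<in> carrier M"
      using y filter_carrier by blast
    have "a \<sqinter> c \<sqsubseteq> b \<sqinter> c"
      using assms c by (intro meet_mono) auto
    then have "a \<sqinter> c = \<bottom>"
      using eq assms c le_bottom_iff by simp
    then show False
      using x y unfolding sigma_iff by blast
  qed
  then show "x \<in> sigma b"
    using x unfolding sigma_iff by blast
qed

lemma sigma_bottom: "sigma \<bottom> = {}"
proof -
  have "\<bottom> \<sqinter> \<top> = \<bottom>"
    using bottom_meet[of \<top>] by (simp add: eq_is_equal)
  then show ?thesis
    unfolding set_eq_iff sigma_iff using filter_top by blast
qed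

lemma sigma_top: "sigma \<top> = filters"
  using mem_imp_sigma[OF _ filter_top] by (auto simp: mt_sigma_def)

section \<open>Closed and open elements of the extension\<close>

definition closed_set :: "'a set \<Rightarrow> 'a set set" where
  "closed_set T = filters \<inter> \<Inter>(sigma ` T)"

lemma closed_set_carrier: "closed_set T \<in> carrier (wallman M)"
  unfolding closed_set_def by (rule W.Int_closed) (use sigma_carrier in blast)

text \<open>Indexing by sets of closed elements of \<open>M\<close> turns arbitrary meets of closed
  elements of the extension into unions of index sets.\<close>

lemma closed_set_Union: "closed_set (\<Union>\<T>) = filters \<inter> (\<Inter>T\<in>\<T>. closed_set T)"
  unfolding closed_set_def by blast

lemma RO_closeds_eq: "RO_closeds M (closeds M) = closed_set ` Pow (closeds M)"
proof -
  have "\<Sqinter>\<^bsub>RO_filters M (closeds M)\<^esub> (sigma ` T) = closed_set T" for T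
    unfolding closed_set_def
    by (rule R.Inf_eq) (use sigma_carrier carrier_RO_filters in blast)
  then show ?thesis
    unfolding RO_closeds_def by (auto simp: subset_image_iff image_iff)
qed

lemma RO_opens_eq: "RO_opens M (closeds M) = (\<lambda>T. W.neg (closed_set T)) ` Pow (closeds M)"
proof -
  have "complement (RO_filters M (closeds M)) (closed_set T) = W.neg (closed_set T)" for T
    by (rule R.complement_eq) (simp add: carrier_RO_filters closed_set_carrier)
  then show ?thesis
    unfolding RO_opens_def RO_closeds_eq image_image by simp
qed

lemma RO_opens_carrier: "V \<in> RO_opens M (closeds M) \<Longrightarrow> V \<in> carrier (wallman M)"
  unfolding RO_opens_eq using W.neg_carrier closed_set_carrier by blast

lemma RO_opens_space: "filters \<in> RO_opens M (closeds M)"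
proof -
  have "W.neg (closed_set {\<bottom>}) = filters"
    unfolding closed_set_def W.neg_def by (auto simp: sigma_bottom)
  then show ?thesis
    unfolding RO_opens_eq using bottom_closeds by blast
qed

text \<open>If \<open>y\<close> avoids both closed sets hereditarily, then some filter above
  \<open>y\<close> contains \<open>c\<close> disjoint from some \<open>a\<close> in \<open>S\<close>
  and \<open>d\<close> disjoint from some \<open>b\<close> in \<open>T\<close>. Their meet is
  disjoint from \<open>a \<squnion> b\<close>, so \<open>y\<close> is not in
  \<open>sigma (a \<squnion> b)\<close>.\<close>

lemma neg_closed_set_Int:
  assumes S: "S \<subseteq> closeds M" and T: "T \<subseteq> closeds M"
  shows "W.neg (closed_set S) \<inter> W.neg (closed_set T) =
    W.neg (closed_set {a \<squnion> b | a b. a \<in> S \<and> b \<in> T})" (is "_ = W.neg (closed_set ?J)")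
proof
  have "sigma a \<subseteq> sigma (a \<squnion> b) \<and> sigma b \<subseteq> sigma (a \<squnion> b)" if "a \<in> S" "b \<in> T" for a b
    using that S T closeds_carrier by (intro conjI sigma_mono join_left join_right join_closed) auto
  then have "closed_set S \<subseteq> closed_set ?J" "closed_set T \<subseteq> closed_set ?J"
    unfolding closed_set_def by blast+
  then show "W.neg (closed_set ?J) \<subseteq> W.neg (closed_set S) \<inter> W.neg (closed_set T)"
    using W.neg_antimono by blast
next
  show "W.neg (closed_set S) \<inter> W.neg (closed_set T) \<subseteq> W.neg (closed_set ?J)"
  proof
    fix x assume x: "x \<in> W.neg (closed_set S) \<inter> W.neg (closed_set T)"
    have "y \<notin> closed_set ?J" if y: "y \<in> filters" "x \<subseteq> y" for y
    proof
      assume yJ: "y \<in> closed_set ?J"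
      have "y \<notin> closed_set S"
        using x y unfolding W.neg_def by blast
      then obtain a z c where a: "a \<in> S" and z: "z \<in> filters" "y \<subseteq> z" "c \<in> z" "a \<sqinter> c = \<bottom>"
        using y by (auto simp: closed_set_def sigma_iff)
      \<comment> \<open>The second extension starts from \<open>z\<close> rather than
        \<open>y\<close>, so that \<open>c\<close> and \<open>d\<close> end up in the same filter
        \<open>w\<close>.\<close>
      have "z \<notin> closed_set T"
        using x y z unfolding W.neg_def by blast
      then obtain b w d where b: "b \<in> T" and w: "w \<in> filters" "z \<subseteq> w" "d \<in> w" "b \<sqinter> d = \<bottom>"
        using z by (auto simp: closed_set_def sigma_iff)
      have cr: "a \<in> carrier M" "b \<in> carrier M" "c \<in> carrier M" "d \<in> carrier M"
        using a b S T z w closeds_carrier filter_carrier by blast+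
      have "c \<sqinter> d \<in> w"
        using z w filter_meet by blast
      moreover have "y \<in> sigma (a \<squnion> b)"
        using yJ a b unfolding closed_set_def by blast
      ultimately have "(a \<squnion> b) \<sqinter> (c \<sqinter> d) \<noteq> \<bottom>"
        using w z unfolding sigma_iff by blast
      moreover have "a \<sqsubseteq> complement M (c \<sqinter> d)"
        using cr z(4) le_trans[OF meet_left[of c d], of "complement M a"]
          meet_eq_bottom_iff[of a c] complement_le_swap[of a "c \<sqinter> d"] by simp
      moreover have "b \<sqsubseteq> complement M (c \<sqinter> d)"
        using cr w(4) le_trans[OF meet_right[of c d], of "complement M b"]
          meet_eq_bottom_iff[of b d] complement_le_swap[of b "c \<sqinter> d"] by simp
      ultimately show False
        using cr join_le[of a "complement M (c \<sqinter> d)" b] meet_eq_bottom_iff[of "a \<squnion> b" "c \<sqinter> d"]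
          complement_le_swap[of "c \<sqinter> d" "a \<squnion> b"] by simp
    qed
    then show "x \<in> W.neg (closed_set ?J)"
      using x unfolding W.neg_def by blast
  qed
qed

lemma RO_opens_Int:
  assumes "U \<in> RO_opens M (closeds M)" "V \<in> RO_opens M (closeds M)"
  shows "U \<inter> V \<in> RO_opens M (closeds M)"
proof -
  obtain S T where ST: "S \<subseteq> closeds M" "T \<subseteq> closeds M"
    "U = W.neg (closed_set S)" "V = W.neg (closed_set T)"
    using assms unfolding RO_opens_eq by blast
  then have "U \<inter> V = W.neg (closed_set {a \<squnion> b | a b. a \<in> S \<and> b \<in> T})"
    using neg_closed_set_Int by simp
  moreover have "{a \<squnion> b | a b. a \<in> S \<and> b \<in> T} \<subseteq> closeds M"
    using ST join_closeds by blast
  ultimately show ?thesis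
    unfolding RO_opens_eq by blast
qed

section \<open>The interior operator of the extension\<close>

lemma interior_exists:
  assumes A: "A \<in> carrier (wallman M)"
  shows "\<exists>U. greatest (RO_filters M (closeds M)) U {V \<in> RO_opens M (closeds M). V \<subseteq> A}"
proof -
  \<comment> \<open>All index sets of open elements below \<open>A\<close> are collected; their
    union then indexes the join of these open elements.\<close>
  define \<T> where "\<T> = {T. T \<subseteq> closeds M \<and> W.neg (closed_set T) \<subseteq> A}"
  let ?U = "W.neg (closed_set (\<Union>\<T>))"
  have "W.neg A \<subseteq> closed_set T" if "T \<in> \<T>" for T
    using that W.neg_antimono[of "W.neg (closed_set T)" A] W.neg_neg[OF closed_set_carrier]
    unfolding \<T>_def by auto
  then have "W.neg A \<subseteq> closed_set (\<Union>\<T>)"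
    unfolding closed_set_Union W.neg_def by blast
  then have "?U \<subseteq> A"
    using W.neg_antimono[of "W.neg A"] W.neg_neg[OF A] by blast
  moreover have "?U \<in> RO_opens M (closeds M)"
    unfolding RO_opens_eq \<T>_def by blast
  moreover have "V \<subseteq> ?U" if "V \<in> RO_opens M (closeds M)" "V \<subseteq> A" for V
  proof -
    obtain T where T: "T \<subseteq> closeds M" "V = W.neg (closed_set T)"
      using \<open>V \<in> RO_opens M (closeds M)\<close> unfolding RO_opens_eq by blast
    then have "T \<in> \<T>"
      using \<open>V \<subseteq> A\<close> unfolding \<T>_def by blast
    then have "closed_set (\<Union>\<T>) \<subseteq> closed_set T"
      unfolding closed_set_Union by blast
    then show ?thesis
      unfolding T by (rule W.neg_antimono)
  qed
  ultimately show ?thesis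
    unfolding greatest_def R.le_eq using RO_opens_carrier carrier_RO_filters by blast
qed

lemma greatest_interior:
  assumes A: "A \<in> carrier (wallman M)"
  shows "greatest (RO_filters M (closeds M)) (box (wallman M) A)
    {V \<in> RO_opens M (closeds M). V \<subseteq> A}"
  unfolding wallman_simps
  by (rule theI') (use interior_exists[OF A] R.greatest_unique in blast)

lemma interior_open: "A \<in> carrier (wallman M) \<Longrightarrow> box (wallman M) A \<in> RO_opens M (closeds M)"
  and interior_subset: "A \<in> carrier (wallman M) \<Longrightarrow> box (wallman M) A \<subseteq> A"
  and interior_maximal:
    "\<lbrakk>A \<in> carrier (wallman M); V \<in> RO_opens M (closeds M); V \<subseteq> A\<rbrakk> \<Longrightarrow> V \<subseteq> box (wallman M) A"
  using greatest_interior[of A] unfolding greatest_def R.le_eq by blast+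

lemma interior_eq_iff:
  assumes "A \<in> carrier (wallman M)"
  shows "A = box (wallman M) A \<longleftrightarrow> A \<in> RO_opens M (closeds M)"
  using assms interior_open[of A] interior_subset[of A] interior_maximal[of A A] by auto

sublocale W: mt_algebra "wallman M"
proof
  fix A assume A: "A \<in> carrier (wallman M)"
  show bA: "box (wallman M) A \<in> carrier (wallman M)"
    using interior_open[OF A] by (rule RO_opens_carrier)
  show "box (wallman M) A \<sqsubseteq>\<^bsub>wallman M\<^esub> A"
    using interior_subset[OF A] by (simp add: W.le_eq)
  show "box (wallman M) A \<sqsubseteq>\<^bsub>wallman M\<^esub> box (wallman M) (box (wallman M) A)"
    using interior_eq_iff[OF bA] interior_open[OF A] by (simp add: W.le_eq)
  fix B assume B: "B \<in> carrier (wallman M)"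
  have AB: "A \<inter> B \<in> carrier (wallman M)"
    using A B W.meet_eq W.meet_closed by metis
  have bB: "box (wallman M) B \<in> carrier (wallman M)"
    using interior_open[OF B] by (rule RO_opens_carrier)
  \<comment> \<open>The intersection of the two interiors is an open element below
    \<open>A \<inter> B\<close>, so maximality of the interiors gives both inclusions.\<close>
  have "box (wallman M) (A \<inter> B) = box (wallman M) A \<inter> box (wallman M) B"
    using interior_open[OF A] interior_open[OF B] interior_open[OF AB] interior_subset[OF A]
      interior_subset[OF B] interior_subset[OF AB] interior_maximal[OF A] interior_maximal[OF B]
      interior_maximal[OF AB] RO_opens_Int[of "box (wallman M) A" "box (wallman M) B"]
    by (meson Int_mono Int_subset_iff subset_antisym)
  then show "box (wallman M) (A \<sqinter>\<^bsub>wallman M\<^esub> B) =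
      box (wallman M) A \<sqinter>\<^bsub>wallman M\<^esub> box (wallman M) B"
    using A B bA bB by (simp add: W.meet_eq)
next
  show "box (wallman M) \<top>\<^bsub>wallman M\<^esub> = \<top>\<^bsub>wallman M\<^esub>"
    using interior_eq_iff[of filters] RO_opens_space RO_opens_carrier by (simp add: W.top_eq_space)
qed

lemma opens_wallman: "opens (wallman M) = RO_opens M (closeds M)"
  unfolding opens_def using interior_eq_iff RO_opens_carrier by blast

lemma closeds_wallman: "closeds (wallman M) = closed_set ` Pow (closeds M)"
proof -
  have "A \<in> closeds (wallman M) \<longleftrightarrow> (\<exists>T\<subseteq>closeds M. A = closed_set T)" for A
    unfolding W.closeds_iff opens_wallman RO_opens_eq
    using closed_set_carrier W.complement_eq W.neg_neg by (auto simp: image_iff) metis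
  then show ?thesis
    by blast
qed

section \<open>Separation and compactness of the extension\<close>

lemma wallman_T1: "mt_T1 (wallman M)"
  unfolding mt_T1_def
proof
  fix U assume U: "U \<in> carrier (wallman M)"
  \<comment> \<open>Every filter \<open>z\<close> above a point \<open>y\<close> of
    \<open>closed_set x\<close> is compatible with \<open>x\<close>. A common extension of the two
    lies in the upset \<open>U\<close>, so \<open>U\<close> is dense above \<open>y\<close> and
    contains \<open>y\<close> by regularity.\<close>
  have sub: "closed_set x \<subseteq> U" if x: "x \<in> U" for x
  proof
    fix y assume y: "y \<in> closed_set x"
    have xf: "x \<in> filters"
      using U x W.carrier_subset by blast
    show "y \<in> U"
    proof (rule W.carrier_memI[OF U])
      show "y \<in> filters"
        using y by (simp add: closed_set_def)
      fix z assume z: "z \<in> filters" "y \<subseteq> z"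
      have "a \<sqinter> b \<noteq> \<bottom>" if "a \<in> x" "b \<in> z" for a b
      proof -
        have "y \<in> sigma a"
          using y that by (simp add: closed_set_def)
        then show ?thesis
          using that z unfolding sigma_iff by blast
      qed
      then obtain w where "w \<in> filters" "x \<subseteq> w" "z \<subseteq> w"
        using common_extension[OF xf z(1)] by blast
      then show "\<exists>w\<in>U. z \<subseteq> w"
        using W.carrier_upset[OF U x] by blast
    qed
  qed
  have mem: "x \<in> closed_set x" if "x \<in> U" for x
    using that U W.carrier_subset mem_imp_sigma unfolding closed_set_def by blast
  have "\<Union>(closed_set ` U) = U"
    using sub mem by blast
  moreover have cl: "closed_set ` U \<subseteq> closeds (wallman M)"
    unfolding closeds_wallman using U W.carrier_subset filter_closeds by blast
  moreover have "closed_set ` U \<subseteq> carrier (wallman M)"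
    using closed_set_carrier by blast
  ultimately have "U = \<Squnion>\<^bsub>wallman M\<^esub> (closed_set ` U)"
    using U W.mem_carrier by (simp add: W.Sup_eq)
  then show "\<exists>S\<subseteq>closeds (wallman M). U = \<Squnion>\<^bsub>wallman M\<^esub> S"
    using cl by blast
qed

text \<open>If no finite subset of \<open>T\<close> had meet \<open>\<bottom>\<close>, the finite
  meets would form a filter base, and the filter generated by it would contain \<open>T\<close> and
  so be a point of \<open>closed_set T\<close>.\<close>

lemma Inter_sigma_eq_empty:
  assumes T: "T \<subseteq> closeds M" and empty: "closed_set T = {}"
  obtains F where "finite F" "F \<subseteq> T" "\<Sqinter>F = \<bottom>"
proof (rule ccontr)
  assume contr: "\<not> thesis"
  let ?S = "{\<Sqinter>F | F. finite F \<and> F \<subseteq> T}"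
  let ?x = "{d \<in> closeds M. \<exists>s\<in>?S. s \<sqsubseteq> d}"
  have Tc: "T \<subseteq> carrier M"
    using T closeds_carrier by blast
  have x: "?x \<in> filters"
  proof (rule generated_filter)
    show "?S \<subseteq> closeds M"
      using T Inf_closeds by blast
    show "\<bottom> \<notin> ?S"
      using contr that by force
    fix a b assume "a \<in> ?S" "b \<in> ?S"
    then obtain F G where "a = \<Sqinter>F" "b = \<Sqinter>G" "finite F" "F \<subseteq> T" "finite G" "G \<subseteq> T"
      by blast
    then have "a \<sqinter> b = \<Sqinter>(F \<union> G)" "finite (F \<union> G)" "F \<union> G \<subseteq> T"
      using Tc Inf_union[of F G] by auto
    then show "a \<sqinter> b \<in> ?S"
      by blast
  qed blast
  have "a \<in> ?x" if "a \<in> T" for a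
  proof -
    have "\<Sqinter>{a} \<sqsubseteq> a" "a \<in> closeds M"
      using that T Tc by auto
    then show ?thesis
      using that by blast
  qed
  then have "?x \<in> closed_set T"
    using x mem_imp_sigma unfolding closed_set_def by blast
  then show False
    using empty by blast
qed

text \<open>A point of \<open>closed_set F\<close> can be enlarged to contain the members of
  \<open>F\<close> one after another, since each \<open>sigma a\<close> is an upset and so still
  contains the enlarged filter. A proper filter would then contain the finite meet
  \<open>\<bottom>\<close>.\<close>

lemma closed_set_eq_empty:
  assumes F: "F \<subseteq> closeds M" "finite F" "\<Sqinter>F = \<bottom>"
  shows "closed_set F = {}"
proof -
  have extend: "\<exists>y\<in>filters. x \<subseteq> y \<and> F \<subseteq> y" if x: "x \<in> closed_set F" for x
    using F(2) F(1) x
  proof (induction F)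
    case empty
    then show ?case
      unfolding closed_set_def by blast
  next
    case (insert a F)
    then have "x \<in> closed_set F"
      unfolding closed_set_def by blast
    then obtain y where y: "y \<in> filters" "x \<subseteq> y" "F \<subseteq> y"
      using insert by blast
    have "x \<in> sigma a"
      using insert.prems unfolding closed_set_def by blast
    then have "y \<in> sigma a"
      using y W.carrier_upset[OF sigma_carrier] by blast
    then obtain z where "z \<in> filters" "y \<subseteq> z" "a \<in> z"
      using sigma_extension insert.prems by blast
    then show ?case
      using y by blast
  qed
  have "\<Sqinter>G \<in> y" if "finite G" "G \<subseteq> y" "y \<in> filters" for G y
    using that
  proof (induction G)
    case empty
    then show ?case
      using filter_top weak_inf_empty by (simp add: eq_is_equal)
  next
    case (insert a G)
    then have "a \<in> carrier M" "G \<subseteq> carrier M"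
      using filter_carrier by blast+
    then have "\<Sqinter>(insert a G) = a \<sqinter> \<Sqinter>G"
      using weak_inf_insert by (simp add: eq_is_equal)
    then show ?case
      using insert filter_meet by simp
  qed
  then show ?thesis
    using F extend filter_bottom by (metis all_not_in_conv)
qed

text \<open>Complementation turns a cover by open elements into a family of closed elements with
  empty meet. A finite set with meet \<open>\<bottom>\<close> drawn from their index sets involves
  only finitely many members of the cover.\<close>

lemma wallman_compact: "mt_compact (wallman M)"
  unfolding mt_compact_def
proof (intro allI impI)
  fix S assume S: "S \<subseteq> opens (wallman M)" and cover: "\<Squnion>\<^bsub>wallman M\<^esub> S = \<top>\<^bsub>wallman M\<^esub>"
  have "\<forall>U\<in>S. \<exists>T\<subseteq>closeds M. U = W.neg (closed_set T)"
    using S unfolding opens_wallman RO_opens_eq by blast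
  then obtain T where T: "\<And>U. U \<in> S \<Longrightarrow> T U \<subseteq> closeds M \<and> U = W.neg (closed_set (T U))"
    by metis
  have Sc: "S \<subseteq> carrier (wallman M)"
    using S unfolding opens_wallman using RO_opens_carrier by blast
  \<comment> \<open>The join is a regularized union, which is the whole space exactly when the union
    has empty \<open>neg\<close>; and that \<open>neg\<close> is the intersection of the
    complementary closed sets.\<close>
  have Sup_top: "\<Squnion>\<^bsub>wallman M\<^esub> V = \<top>\<^bsub>wallman M\<^esub> \<longleftrightarrow> filters \<inter> (\<Inter>U\<in>V. closed_set (T U)) = {}"
    if V: "V \<subseteq> S" for V
  proof -
    have neg: "W.neg U = closed_set (T U)" if "U \<in> V" for U
      using that V T W.neg_neg[OF closed_set_carrier] by (metis subsetD)
    have "x \<in> W.neg (\<Union>V) \<longleftrightarrow> x \<in> filters \<inter> (\<Inter>U\<in>V. W.neg U)" for x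
      unfolding W.neg_def by blast
    then have "W.neg (\<Union>V) = filters \<inter> (\<Inter>U\<in>V. closed_set (T U))"
      using neg by (simp add: set_eq_iff)
    moreover have "W.regularize (\<Union>V) = filters \<longleftrightarrow> W.neg (\<Union>V) = {}"
    proof -
      have "\<Union>V \<subseteq> filters"
        using Sc V W.carrier_subset by blast
      then show ?thesis
        unfolding W.regularize_def W.neg_def set_eq_iff mem_Collect_eq empty_iff
        by (meson order_refl subsetD subset_trans)
    qed
    ultimately show ?thesis
      using V Sc by (simp add: W.Sup_eq W.top_eq_space)
  qed
  have "closed_set (\<Union>U\<in>S. T U) = {}"
    using Sup_top[of S] cover unfolding closed_set_Union by simp
  moreover have "(\<Union>U\<in>S. T U) \<subseteq> closeds M"
    using T by blast
  ultimately obtain F where F: "finite F" "F \<subseteq> (\<Union>U\<in>S. T U)" "\<Sqinter>F = \<bottom>"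
    using Inter_sigma_eq_empty by metis
  then obtain V where V: "finite V" "V \<subseteq> S" "F \<subseteq> (\<Union>U\<in>V. T U)"
    using finite_subset_Union[of F "T ` S"] by (metis finite_subset_image Union_mono)
  have "F \<subseteq> closeds M"
    using V T by blast
  then have "closed_set F = {}"
    using F closed_set_eq_empty by blast
  moreover have "closed_set (\<Union>U\<in>V. T U) \<subseteq> closed_set F"
    using V(3) unfolding closed_set_def by blast
  ultimately have "\<Squnion>\<^bsub>wallman M\<^esub> V = \<top>\<^bsub>wallman M\<^esub>"
    using Sup_top[OF V(2)] unfolding closed_set_Union by simp
  then show "\<exists>V\<subseteq>S. finite V \<and> \<Squnion>\<^bsub>wallman M\<^esub> V = \<top>\<^bsub>wallman M\<^esub>"
    using V by blast
qed

section \<open>The Wallman map\<close>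

lemma le_iff_atoms:
  assumes m: "m \<in> carrier M" and n: "n \<in> carrier M"
  shows "m \<sqsubseteq> n \<longleftrightarrow> (\<forall>a\<in>atoms M. a \<sqsubseteq> m \<longrightarrow> a \<sqsubseteq> n)"
proof
  assume "m \<sqsubseteq> n"
  then show "\<forall>a\<in>atoms M. a \<sqsubseteq> m \<longrightarrow> a \<sqsubseteq> n"
    using le_trans[OF _ _ atom_closed m n] by simp
next
  assume *: "\<forall>a\<in>atoms M. a \<sqsubseteq> m \<longrightarrow> a \<sqsubseteq> n"
  \<comment> \<open>Spatiality enters here: a nonzero difference of \<open>m\<close> and
    \<open>n\<close> would contain an atom.\<close>
  have "m \<sqinter> complement M n = \<bottom>"
  proof (rule ccontr)
    assume "m \<sqinter> complement M n \<noteq> \<bottom>"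
    then obtain a where a: "a \<in> atoms M" "a \<sqsubseteq> m \<sqinter> complement M n"
      using spatial m n unfolding mt_spatial_def by (meson complement_closed meet_closed)
    have "a \<sqsubseteq> m" "a \<sqsubseteq> complement M n"
      using le_trans[OF a(2) meet_left] le_trans[OF a(2) meet_right] atom_closed[OF a(1)] m n
      by simp_all
    then show False
      using * a n atom_le_complement_iff by blast
  qed
  then show "m \<sqsubseteq> n"
    using m n meet_eq_bottom_iff[of m "complement M n"]
      complement_antimono[of "complement M n" "complement M m"] by simp
qed

lemma eq_iff_atoms:
  assumes "m \<in> carrier M" "n \<in> carrier M"
  shows "m = n \<longleftrightarrow> (\<forall>a\<in>atoms M. a \<sqsubseteq> m \<longleftrightarrow> a \<sqsubseteq> n)"
  using assms le_iff_atoms[of m n] le_iff_atoms[of n m] le_antisym by blast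

text \<open>By \<open>T1\<close> the atom is a join of closed elements. Being join-prime, it lies
  below one of them, which must then equal it.\<close>

lemma atom_closeds:
  assumes a: "a \<in> atoms M"
  shows "a \<in> closeds M"
proof -
  have ac: "a \<in> carrier M"
    using a by (rule atom_closed)
  obtain S where S: "S \<subseteq> closeds M" "a = \<Squnion>S"
    using T1 ac unfolding mt_T1_def by blast
  have Sc: "S \<subseteq> carrier M"
    using S closeds_carrier by blast
  obtain s where s: "s \<in> S" "a \<sqsubseteq> s"
    using atom_le_Sup_iff[OF a Sc] S ac by auto
  have "s = a"
    using s S Sc ac sup_upper[OF Sc s(1)] by (metis le_antisym subsetD)
  then show ?thesis
    using s S by blast
qed

lemma principal_atom_filter: "a \<in> atoms M \<Longrightarrow> principal a \<in> filters"
  using principal_filter atom_closeds atom_not_bottom by blast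

text \<open>Such a \<open>y\<close> contains \<open>a\<close> itself, so each of its members meets
  \<open>a\<close> in a nonzero element and hence lies above the atom.\<close>

lemma principal_atom_maximal:
  assumes a: "a \<in> atoms M" and y: "y \<in> filters" "principal a \<subseteq> y"
  shows "y = principal a"
proof
  have "a \<in> y"
    using a y atom_closeds atom_closed unfolding principal_def by blast
  then have "a \<sqsubseteq> b" if "b \<in> y" for b
    using atom_meet_iff[OF a filter_carrier[OF y(1) that]] filter_meet[OF y(1) _ that]
      filter_bottom[OF y(1)] by metis
  then show "y \<subseteq> principal a"
    using y filter_closeds unfolding principal_def by blast
qed (rule y(2))

text \<open>By maximality only the members of \<open>principal a\<close> have to be tested against
  \<open>m\<close>, and among these the least one, \<open>a\<close>, is decisive.\<close>

lemma principal_mem_sigma_iff: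
  assumes a: "a \<in> atoms M" and m: "m \<in> carrier M"
  shows "principal a \<in> sigma m \<longleftrightarrow> a \<sqsubseteq> m"
proof -
  have ac: "a \<in> closeds M" "a \<in> carrier M"
    using a atom_closeds atom_closed by blast+
  have "principal a \<in> sigma m \<longleftrightarrow> (\<forall>b\<in>principal a. m \<sqinter> b \<noteq> \<bottom>)"
    unfolding sigma_iff using principal_atom_filter[OF a] principal_atom_maximal[OF a] by blast
  also have "\<dots> \<longleftrightarrow> m \<sqinter> a \<noteq> \<bottom>"
  proof
    assume ma: "m \<sqinter> a \<noteq> \<bottom>"
    have "m \<sqinter> a \<sqsubseteq> m \<sqinter> b" if "b \<in> principal a" for b
      using that m ac closeds_carrier by (intro meet_mono) (auto simp: principal_def)
    then show "\<forall>b\<in>principal a. m \<sqinter> b \<noteq> \<bottom>"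
      using ma m ac le_bottom_iff[of "m \<sqinter> a"] by force
  qed (use ac in \<open>auto simp: principal_def\<close>)
  finally show ?thesis
    using atom_meet_iff[OF a m] by (metis meet_comm)
qed

text \<open>Every filter extending a member of \<open>sigma a\<close> consists of elements above
  \<open>a\<close>, so it lies inside \<open>principal a\<close>. If that point is in
  \<open>A\<close>, then \<open>A\<close> is dense above each member of
  \<open>sigma a\<close>.\<close>

lemma sigma_atom_subset_iff:
  assumes a: "a \<in> atoms M" and A: "A \<in> carrier (wallman M)"
  shows "sigma a \<subseteq> A \<longleftrightarrow> principal a \<in> A"
proof
  assume "sigma a \<subseteq> A"
  then show "principal a \<in> A"
    using principal_mem_sigma_iff[OF a] atom_closed[OF a] by blast
next
  assume pA: "principal a \<in> A"
  show "sigma a \<subseteq> A"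
  proof
    fix x assume x: "x \<in> sigma a"
    show "x \<in> A"
    proof (rule W.carrier_memI[OF A])
      show "x \<in> filters"
        using x unfolding sigma_iff by blast
      fix y assume y: "y \<in> filters" "x \<subseteq> y"
      have "a \<sqsubseteq> b" if "b \<in> y" for b
        using x y that atom_meet_iff[OF a filter_carrier[OF y(1) that]] unfolding sigma_iff by blast
      then have "y \<subseteq> principal a"
        using y filter_closeds unfolding principal_def by blast
      then show "\<exists>z\<in>A. y \<subseteq> z"
        using pA by blast
    qed
  qed
qed

section \<open>The Wallman map as a complete homomorphism\<close>

lemma wallman_map_closed: "wallman_map M A \<in> carrier M"
  unfolding wallman_map_def by (rule sup_closed) (use atom_closed in blast)

text \<open>Atoms are pairwise incomparable and join-prime, so \<open>a\<close> is below the
  defining join only by occurring in it. Algebraic properties of the map thereby reduce to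
  evaluation at the points \<open>principal a\<close>.\<close>

lemma atom_le_wallman_map_iff:
  assumes a: "a \<in> atoms M" and A: "A \<in> carrier (wallman M)"
  shows "a \<sqsubseteq> wallman_map M A \<longleftrightarrow> principal a \<in> A"
proof -
  have "a \<sqsubseteq> wallman_map M A \<longleftrightarrow> (\<exists>b\<in>{b \<in> atoms M. sigma b \<subseteq> A}. a \<sqsubseteq> b)"
    unfolding wallman_map_def by (rule atom_le_Sup_iff[OF a]) (use atom_closed in blast)
  also have "\<dots> \<longleftrightarrow> sigma a \<subseteq> A"
    using a atom_le_atom atom_closed le_refl by blast
  finally show ?thesis
    by (simp add: sigma_atom_subset_iff[OF a A])
qed

text \<open>Both sides have the same atoms below them. Thus \<open>sigma\<close> is a section of the
  map, which makes the map onto.\<close>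

lemma wallman_map_sigma:
  assumes "m \<in> carrier M"
  shows "wallman_map M (sigma m) = m"
  using assms eq_iff_atoms[OF wallman_map_closed assms] atom_le_wallman_map_iff[OF _ sigma_carrier]
    principal_mem_sigma_iff by blast

lemma wallman_map_Sup:
  assumes S: "S \<subseteq> carrier (wallman M)"
  shows "wallman_map M (\<Squnion>\<^bsub>wallman M\<^esub> S) = \<Squnion>(wallman_map M ` S)"
proof -
  have img: "wallman_map M ` S \<subseteq> carrier M"
    using wallman_map_closed by blast
  have "a \<sqsubseteq> wallman_map M (\<Squnion>\<^bsub>wallman M\<^esub> S) \<longleftrightarrow> a \<sqsubseteq> \<Squnion>(wallman_map M ` S)"
    if a: "a \<in> atoms M" for a
  proof -
    \<comment> \<open>The only filter above \<open>principal a\<close> is itself, so regularization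
      adds nothing at this point.\<close>
    have "principal a \<in> W.regularize (\<Union>S) \<longleftrightarrow> principal a \<in> \<Union>S"
      unfolding W.regularize_def
      using principal_atom_filter[OF a] principal_atom_maximal[OF a] by blast
    then have "a \<sqsubseteq> wallman_map M (\<Squnion>\<^bsub>wallman M\<^esub> S) \<longleftrightarrow> (\<exists>A\<in>S. principal a \<in> A)"
      using atom_le_wallman_map_iff[OF a W.sup_closed[OF S]] W.Sup_eq[OF S] by simp
    also have "\<dots> \<longleftrightarrow> (\<exists>A\<in>S. a \<sqsubseteq> wallman_map M A)"
      using S atom_le_wallman_map_iff[OF a] by blast
    finally show ?thesis
      using atom_le_Sup_iff[OF a img] by simp
  qed
  then show ?thesis
    by (simp add: eq_iff_atoms[OF wallman_map_closed sup_closed[OF img]])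
qed

lemma wallman_map_Inf:
  assumes S: "S \<subseteq> carrier (wallman M)"
  shows "wallman_map M (\<Sqinter>\<^bsub>wallman M\<^esub> S) = \<Sqinter>(wallman_map M ` S)"
proof -
  have img: "wallman_map M ` S \<subseteq> carrier M"
    using wallman_map_closed by blast
  have "a \<sqsubseteq> wallman_map M (\<Sqinter>\<^bsub>wallman M\<^esub> S) \<longleftrightarrow> a \<sqsubseteq> \<Sqinter>(wallman_map M ` S)"
    if a: "a \<in> atoms M" for a
  proof -
    have "a \<sqsubseteq> wallman_map M (\<Sqinter>\<^bsub>wallman M\<^esub> S) \<longleftrightarrow> (\<forall>A\<in>S. principal a \<in> A)"
      using atom_le_wallman_map_iff[OF a W.inf_closed[OF S]] principal_atom_filter[OF a] W.Inf_eq[OF S]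
      by simp
    also have "\<dots> \<longleftrightarrow> (\<forall>A\<in>S. a \<sqsubseteq> wallman_map M A)"
      using S atom_le_wallman_map_iff[OF a] by blast
    finally show ?thesis
      using le_Inf_iff[OF atom_closed[OF a] img] by simp
  qed
  then show ?thesis
    by (simp add: eq_iff_atoms[OF wallman_map_closed inf_closed[OF img]])
qed

lemma wallman_map_complement:
  assumes A: "A \<in> carrier (wallman M)"
  shows "wallman_map M (complement (wallman M) A) = complement M (wallman_map M A)"
proof -
  have "a \<sqsubseteq> wallman_map M (complement (wallman M) A) \<longleftrightarrow> a \<sqsubseteq> complement M (wallman_map M A)"
    if a: "a \<in> atoms M" for a
  proof -
    have "principal a \<in> W.neg A \<longleftrightarrow> principal a \<notin> A"
      unfolding W.neg_def using principal_atom_filter[OF a] principal_atom_maximal[OF a] by blast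
    then show ?thesis
      using A atom_le_wallman_map_iff[OF a] atom_le_complement_iff[OF a wallman_map_closed]
        W.complement_eq[OF A] W.neg_carrier[OF A] by simp
  qed
  then show ?thesis
    by (simp add: eq_iff_atoms[OF wallman_map_closed complement_closed[OF wallman_map_closed]])
qed

section \<open>Embedding and density\<close>

lemma wallman_map_closed_set:
  assumes T: "T \<subseteq> closeds M"
  shows "wallman_map M (closed_set T) = \<Sqinter>T"
proof -
  have sc: "sigma ` T \<subseteq> carrier (wallman M)"
    using sigma_carrier by blast
  \<comment> \<open>Written as a meet of values of \<open>sigma\<close>, the closed set is sent to
    the meet of \<open>T\<close>, because meets are preserved and the map undoes
    \<open>sigma\<close>.\<close>
  have "closed_set T = \<Sqinter>\<^bsub>wallman M\<^esub> (sigma ` T)"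
    using W.Inf_eq[OF sc] by (simp add: closed_set_def)
  moreover have "wallman_map M (sigma b) = b" if "b \<in> T" for b
    using T that by (intro wallman_map_sigma closeds_carrier) blast
  then have "wallman_map M ` sigma ` T = T"
    by (simp add: image_image)
  ultimately show ?thesis
    using wallman_map_Inf[OF sc] by simp
qed

lemma wallman_map_closeds: "wallman_map M ` closeds (wallman M) = closeds M"
proof
  show "wallman_map M ` closeds (wallman M) \<subseteq> closeds M"
    by (auto simp: closeds_wallman wallman_map_closed_set Inf_closeds)
  show "closeds M \<subseteq> wallman_map M ` closeds (wallman M)"
  proof
    fix m assume m: "m \<in> closeds M"
    then have "wallman_map M (closed_set {m}) = m"
      using wallman_map_closed_set[of "{m}"] closeds_carrier[OF m] by simp
    then show "m \<in> wallman_map M ` closeds (wallman M)"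
      unfolding closeds_wallman using m by (metis PowI empty_subsetI image_eqI insert_subset)
  qed
qed

lemma wallman_map_opens: "wallman_map M ` opens (wallman M) = opens M"
proof
  show "wallman_map M ` opens (wallman M) \<subseteq> opens M"
  proof clarify
    fix U assume "U \<in> opens (wallman M)"
    then have U: "U \<in> carrier (wallman M)" "complement (wallman M) U \<in> closeds (wallman M)"
      using W.opens_carrier W.open_iff_complement_closed by blast+
    then have "complement M (wallman_map M U) \<in> closeds M"
      using wallman_map_closeds wallman_map_complement by (metis imageI)
    then show "wallman_map M U \<in> opens M"
      using wallman_map_closed open_iff_complement_closed by blast
  qed
  show "opens M \<subseteq> wallman_map M ` opens (wallman M)"
  proof
    fix u assume "u \<in> opens M"
    then have u: "u \<in> carrier M" "complement M u \<in> closeds M"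
      using opens_carrier open_iff_complement_closed by blast+
    then obtain C where C: "C \<in> closeds (wallman M)" "wallman_map M C = complement M u"
      using wallman_map_closeds by (metis imageE)
    have "wallman_map M (complement (wallman M) C) = u"
      using C u wallman_map_complement W.closeds_carrier by simp
    then show "u \<in> wallman_map M ` opens (wallman M)"
      using C W.closeds_iff by (metis imageI)
  qed
qed

lemma wallman_map_mono:
  assumes "A \<in> carrier (wallman M)" "B \<in> carrier (wallman M)" "A \<subseteq> B"
  shows "wallman_map M A \<sqsubseteq> wallman_map M B"
  using assms atom_le_wallman_map_iff
  by (auto simp: le_iff_atoms[OF wallman_map_closed wallman_map_closed])

text \<open>The image of \<open>box (wallman M) A\<close> is open and lies below the image of
  \<open>A\<close>, hence below the box of that image.\<close>

lemma wallman_morphism: "mt_morphism (wallman M) M (wallman_map M)"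
proof (intro mt_morphism.intro mt_morphism_axioms.intro)
  show "mt_algebra (wallman M)" "mt_algebra M"
    by unfold_locales
  show "wallman_map M (box (wallman M) A) \<sqsubseteq> box M (wallman_map M A)"
    if A: "A \<in> carrier (wallman M)" for A
  proof (rule box_greatest)
    show "wallman_map M (box (wallman M) A) \<in> opens M"
      using wallman_map_opens W.box_open[OF A] by blast
    show "wallman_map M (box (wallman M) A) \<sqsubseteq> wallman_map M A"
      using A interior_subset[OF A] by (intro wallman_map_mono W.box_in_carrier)
  qed (rule wallman_map_closed)
qed (use wallman_map_closed wallman_map_Sup wallman_map_Inf wallman_map_complement in auto)

lemma wallman_embedding: "mt_embedding (wallman M) M (wallman_map M)"
proof -
  have "wallman_map M ` carrier (wallman M) = carrier M"
  proof
    show "carrier M \<subseteq> wallman_map M ` carrier (wallman M)"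
    proof
      fix m assume "m \<in> carrier M"
      then have "m = wallman_map M (sigma m)"
        by (simp add: wallman_map_sigma)
      then show "m \<in> wallman_map M ` carrier (wallman M)"
        using sigma_carrier by (rule image_eqI)
    qed
  qed (use wallman_map_closed in blast)
  then show ?thesis
    using wallman_morphism wallman_map_opens by (simp add: mt_embedding_def)
qed

text \<open>If the complement of \<open>closed_set T\<close> is sent to \<open>\<bottom>\<close>,
  the meet of \<open>T\<close> is \<open>\<top>\<close>. Then \<open>\<top>\<close> is the only
  possible member of \<open>T\<close>, so \<open>closed_set T\<close> is the whole space and its
  complement is empty.\<close>

lemma wallman_dense: "mt_dense (wallman M) M (wallman_map M)"
  unfolding mt_dense_def
proof (intro ballI impI)
  fix U assume U: "U \<in> opens (wallman M)" and zero: "wallman_map M U = \<bottom>"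
  then obtain T where T: "T \<subseteq> closeds M" "U = W.neg (closed_set T)"
    unfolding opens_wallman RO_opens_eq by blast
  have "complement M (\<Sqinter>T) = \<bottom>"
    using zero T wallman_map_complement[OF closed_set_carrier] wallman_map_closed_set
      W.complement_eq[OF closed_set_carrier] by simp
  moreover have Tc: "T \<subseteq> carrier M"
    using T closeds_carrier by blast
  ultimately have "\<Sqinter>T = \<top>"
    using complement_bottom complement_complement[of "\<Sqinter>T"] by simp
  then have "t = \<top>" if "t \<in> T" for t
    using inf_lower[OF Tc that] that Tc by (metis le_antisym subsetD top_closed top_higher)
  then have "closed_set T = filters"
    unfolding closed_set_def using sigma_top by blast
  then show "U = \<bottom>\<^bsub>wallman M\<^esub>"
    unfolding T W.bottom_eq_empty W.neg_def by blast
qed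

end

theorem corollary4p10:
  fixes M :: "('a, 'm) mt_scheme"
  assumes "mt_algebra M" and "mt_spatial M" and "mt_T1 M"
  shows "mt_T1_compactification M (wallman M) (wallman_map M)"
proof -
  interpret spatial_T1_mt_algebra M
    using assms by (intro spatial_T1_mt_algebra.intro spatial_T1_mt_algebra_axioms.intro)
  show ?thesis
    unfolding mt_T1_compactification_def mt_compactification_def
    using W.mt_algebra_axioms wallman_compact wallman_embedding wallman_dense wallman_T1 by blast
qed

end
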